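(* Let $A$ be a $\Delta$-separable Frobenius algebra in a symmetric strict monoidal category whose Nakayama automorphism is an involution. Set $$t=\varepsilon\circ\mu\circ(\mu\otimes\mathrm{id}_A),\qquad c_{-1}=\Delta\circ\eta,\qquad c_1=\sigma_{A,A}\circ\Delta\circ\eta .$$ Then $t:A^{\otimes3}\to\mathbf 1$ and $c_{\pm1}:\mathbf 1\to A\otimes A$ satisfy the following relations (in the index notation explained in the context), for all choices of signs in $\{\pm1\}$: 1. $c_1=\sigma_{A,A}\circ c_{-1}$. 2. $t_{xyz}\,c_{\alpha}^{xx'}c_{\beta}^{yy'}c_{\gamma}^{zz'}=t_{xyz}\,c_{-\alpha}^{xx'}c_{-\beta}^{yy'}c_{-\gamma}^{zz'}$, with outputs $(x',y',z')$. 3. $t_{xyz}\,c_{\alpha}^{xx'}c_{\beta}^{yy'}c_{\gamma}^{zz'}=t_{yzx}\,c_{-\alpha}^{xx'}c_{\beta}^{yy'}c_{\gamma}^{zz'}$, with outputs $(x',y',z')$. 4. $t_{uab}\,t_{vcd}\,c_s^{uv}c_{s_A}^{aa'}c_{s_B}^{bb'}c_{s_C}^{cc'}c_{s_D}^{dd'}=t_{ubc}\,t_{vda}\,c_s^{uv}c_{s_A}^{aa'}c_{-ss_B}^{bb'}c_{-s_C}^{cc'}c_{-ss_D}^{dd'}$, with outputs $(a',b',c',d')$. 5. $t_{auw'}\,t_{bvu'}\,t_{cwv'}\,c_{s_{12}}^{uu'}c_{s_{23}}^{vv'}c_{s_{31}}^{ww'}c_{s_A}^{aa'}c_{s_B}^{bb'}c_{s_C}^{cc'}=t_{abc}\,c_{s_A}^{aa'}c_{s_{12}s_B}^{bb'}c_{-s_{31}s_C}^{cc'}$,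 with outputs $(a',b',c')$, whenever $s_{12}s_{23}s_{31}=-1$.
   Context: The category has tensor unit $\mathbf 1$ and symmetric braiding $\sigma_{U,V}$. A Frobenius algebra is an object $A$ with a unital associative algebra structure $(\mu,\eta)$ and a counital coassociative coalgebra structure $(\Delta,\varepsilon)$ such that $(\mathrm{id}\otimes\mu)(\Delta\otimes\mathrm{id})=\Delta\mu=(\mu\otimes\mathrm{id})(\mathrm{id}\otimes\Delta)$. Put $b=\varepsilon\circ\mu$. The Nakayama automorphism is $N=(b\otimes\mathrm{id}_A)\circ(\mathrm{id}_A\otimes\sigma_{A,A})\circ(\mathrm{id}_A\otimes(\Delta\circ\eta))$. $A$ is $\Delta$-separable if $\mu\circ\Delta\circ\eta=\eta$ (equivalently $\mu\circ\Delta=\mathrm{id}_A$). Index notation: $c_\alpha^{xx'}$ denotes $c_\alpha:\mathbf 1\to A\otimes A$ with first output labelled $x$ and second output labelled $x'$; $t_{xyz}$ denotes $t:A^{\otimes3}\to\mathbf 1$ with first, second, third inputs labelled $x,y,z$. A product of such symbols denotes the morphism obtained by tensoring all the $c$'s, permuting the outputs by the symmetric braiding, and feeding each output whose label occurs as a label of an input of some $t$ into that input; the remaining unmatched labels are the outputs of the composite, in the stated order. Thus both sides of relations 2, 3, 5 are morphisms $\mathbf 1\to A^{\otimes3}$ and both sides of relation 4 are morphisms $\mathbf 1\to A^{\otimes4}$. *)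

theory Defs
  imports Main
begin

section \<open>Symmetric strict monoidal categories\<close>

record ('o, 'm) monoidal_data =
  Ob :: "'o set"
  Mor :: "'m set"
  Dom :: "'m \<Rightarrow> 'o"
  Cod :: "'m \<Rightarrow> 'o"
  Id :: "'o \<Rightarrow> 'm" ("\<iota>\<index>")
  Comp :: "'m \<Rightarrow> 'm \<Rightarrow> 'm" (infixr "\<cdot>\<index>" 65)
  Unit :: "'o" ("\<one>\<index>")
  TensorOb :: "'o \<Rightarrow> 'o \<Rightarrow> 'o" (infixr "\<odot>\<index>" 75)
  TensorMor :: "'m \<Rightarrow> 'm \<Rightarrow> 'm" (infixr "\<otimes>\<index>" 75)
  Braid :: "'o \<Rightarrow> 'o \<Rightarrow> 'm" ("\<sigma>\<index>")

text \<open>Composition is in applicative order: \<open>g \<cdot> f\<close> is \<open>f\<close> followed by \<open>g\<close>. Its value, and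
  that of the other operations, is unconstrained outside the intended domain.\<close>

definition hom :: "('o, 'm, 'z) monoidal_data_scheme \<Rightarrow> 'o \<Rightarrow> 'o \<Rightarrow> 'm set" where
  "hom C X Y = {f \<in> Mor C. Dom C f = X \<and> Cod C f = Y}"

locale category =
  fixes C :: "('o, 'm, 'z) monoidal_data_scheme" (structure)
  assumes Dom_closed: "f \<in> Mor C \<Longrightarrow> Dom C f \<in> Ob C"
    and Cod_closed: "f \<in> Mor C \<Longrightarrow> Cod C f \<in> Ob C"
    and Id_hom: "X \<in> Ob C \<Longrightarrow> \<iota> X \<in> hom C X X"
    and Comp_hom: "\<lbrakk>f \<in> hom C X Y; g \<in> hom C Y Z\<rbrakk> \<Longrightarrow> g \<cdot> f \<in> hom C X Z"
    and Comp_Id_left: "f \<in> hom C X Y \<Longrightarrow> \<iota> Y \<cdot> f = f"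
    and Comp_Id_right: "f \<in> hom C X Y \<Longrightarrow> f \<cdot> \<iota> X = f"
    and Comp_assoc: "\<lbrakk>f \<in> hom C W X; g \<in> hom C X Y; h \<in> hom C Y Z\<rbrakk>
      \<Longrightarrow> (h \<cdot> g) \<cdot> f = h \<cdot> (g \<cdot> f)"

locale strict_monoidal_category = category +
  assumes Unit_Ob: "\<one> \<in> Ob C"
    and TensorOb_closed: "\<lbrakk>X \<in> Ob C; Y \<in> Ob C\<rbrakk> \<Longrightarrow> X \<odot> Y \<in> Ob C"
    and TensorOb_Unit_left: "X \<in> Ob C \<Longrightarrow> \<one> \<odot> X = X"
    and TensorOb_Unit_right: "X \<in> Ob C \<Longrightarrow> X \<odot> \<one> = X"
    and TensorOb_assoc: "\<lbrakk>X \<in> Ob C; Y \<in> Ob C; Z \<in> Ob C\<rbrakk> \<Longrightarrow> (X \<odot> Y) \<odot> Z = X \<odot> (Y \<odot> Z)"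
    and TensorMor_hom: "\<lbrakk>f \<in> hom C X Y; g \<in> hom C X' Y'\<rbrakk> \<Longrightarrow> f \<otimes> g \<in> hom C (X \<odot> X') (Y \<odot> Y')"
    and TensorMor_Id: "\<lbrakk>X \<in> Ob C; Y \<in> Ob C\<rbrakk> \<Longrightarrow> \<iota> X \<otimes> \<iota> Y = \<iota> (X \<odot> Y)"
    and interchange: "\<lbrakk>f \<in> hom C X Y; g \<in> hom C Y Z; f' \<in> hom C X' Y'; g' \<in> hom C Y' Z'\<rbrakk>
      \<Longrightarrow> (g \<cdot> f) \<otimes> (g' \<cdot> f') = (g \<otimes> g') \<cdot> (f \<otimes> f')"
    and TensorMor_Unit_left: "f \<in> Mor C \<Longrightarrow> \<iota> \<one> \<otimes> f = f"
    and TensorMor_Unit_right: "f \<in> Mor C \<Longrightarrow> f \<otimes> \<iota> \<one> = f"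
    and TensorMor_assoc: "\<lbrakk>f \<in> Mor C; g \<in> Mor C; h \<in> Mor C\<rbrakk> \<Longrightarrow> (f \<otimes> g) \<otimes> h = f \<otimes> (g \<otimes> h)"

text \<open>By symmetry, one hexagon identity implies the other; triviality of the braiding with the
  unit object follows as well.\<close>

locale symmetric_strict_monoidal_category = strict_monoidal_category +
  assumes Braid_hom: "\<lbrakk>X \<in> Ob C; Y \<in> Ob C\<rbrakk> \<Longrightarrow> \<sigma> X Y \<in> hom C (X \<odot> Y) (Y \<odot> X)"
    and Braid_natural: "\<lbrakk>f \<in> hom C X X'; g \<in> hom C Y Y'\<rbrakk>
      \<Longrightarrow> \<sigma> X' Y' \<cdot> (f \<otimes> g) = (g \<otimes> f) \<cdot> \<sigma> X Y"
    and Braid_hexagon: "\<lbrakk>X \<in> Ob C; Y \<in> Ob C; Z \<in> Ob C\<rbrakk>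
      \<Longrightarrow> \<sigma> X (Y \<odot> Z) = (\<iota> Y \<otimes> \<sigma> X Z) \<cdot> (\<sigma> X Y \<otimes> \<iota> Z)"
    and Braid_symmetric: "\<lbrakk>X \<in> Ob C; Y \<in> Ob C\<rbrakk> \<Longrightarrow> \<sigma> Y X \<cdot> \<sigma> X Y = \<iota> (X \<odot> Y)"


section \<open>Frobenius algebras\<close>

locale frobenius_algebra = strict_monoidal_category C
  for C :: "('o, 'm, 'z) monoidal_data_scheme" (structure) +
  fixes A :: 'o and \<mu> \<eta> \<Delta> \<epsilon> :: 'm
  assumes A_Ob: "A \<in> Ob C"
    and mult_hom: "\<mu> \<in> hom C (A \<odot> A) A"
    and unit_hom: "\<eta> \<in> hom C \<one> A"
    and comult_hom: "\<Delta> \<in> hom C A (A \<odot> A)"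
    and counit_hom: "\<epsilon> \<in> hom C A \<one>"
    and mult_assoc: "\<mu> \<cdot> (\<mu> \<otimes> \<iota> A) = \<mu> \<cdot> (\<iota> A \<otimes> \<mu>)"
    and mult_unit_left: "\<mu> \<cdot> (\<eta> \<otimes> \<iota> A) = \<iota> A"
    and mult_unit_right: "\<mu> \<cdot> (\<iota> A \<otimes> \<eta>) = \<iota> A"
    and comult_coassoc: "(\<Delta> \<otimes> \<iota> A) \<cdot> \<Delta> = (\<iota> A \<otimes> \<Delta>) \<cdot> \<Delta>"
    and comult_counit_left: "(\<epsilon> \<otimes> \<iota> A) \<cdot> \<Delta> = \<iota> A"
    and comult_counit_right: "(\<iota> A \<otimes> \<epsilon>) \<cdot> \<Delta> = \<iota> A"
    and frobenius_left: "(\<iota> A \<otimes> \<mu>) \<cdot> (\<Delta> \<otimes> \<iota> A) = \<Delta> \<cdot> \<mu>"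
    and frobenius_right: "(\<mu> \<otimes> \<iota> A) \<cdot> (\<iota> A \<otimes> \<Delta>) = \<Delta> \<cdot> \<mu>"

definition Delta_separable ::
  "('o, 'm, 'z) monoidal_data_scheme \<Rightarrow> 'm \<Rightarrow> 'm \<Rightarrow> 'm \<Rightarrow> bool" where
  "Delta_separable C \<mu> \<eta> \<Delta> \<longleftrightarrow> \<mu> \<cdot>\<^bsub>C\<^esub> \<Delta> \<cdot>\<^bsub>C\<^esub> \<eta> = \<eta>"

definition nakayama ::
  "('o, 'm, 'z) monoidal_data_scheme \<Rightarrow> 'o \<Rightarrow> 'm \<Rightarrow> 'm \<Rightarrow> 'm \<Rightarrow> 'm \<Rightarrow> 'm" where
  "nakayama C A \<mu> \<eta> \<Delta> \<epsilon> =
    (let b = \<epsilon> \<cdot>\<^bsub>C\<^esub> \<mu>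
     in (b \<otimes>\<^bsub>C\<^esub> \<iota>\<^bsub>C\<^esub> A) \<cdot>\<^bsub>C\<^esub> (\<iota>\<^bsub>C\<^esub> A \<otimes>\<^bsub>C\<^esub> \<sigma>\<^bsub>C\<^esub> A A) \<cdot>\<^bsub>C\<^esub> (\<iota>\<^bsub>C\<^esub> A \<otimes>\<^bsub>C\<^esub> (\<Delta> \<cdot>\<^bsub>C\<^esub> \<eta>)))"


section \<open>Index notation\<close>

primrec tensor_power :: "('o, 'm, 'z) monoidal_data_scheme \<Rightarrow> 'o \<Rightarrow> nat \<Rightarrow> 'o" where
  "tensor_power C A 0 = \<one>\<^bsub>C\<^esub>"
| "tensor_power C A (Suc n) = A \<odot>\<^bsub>C\<^esub> tensor_power C A n"

primrec tensor_list :: "('o, 'm, 'z) monoidal_data_scheme \<Rightarrow> 'm list \<Rightarrow> 'm" where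
  "tensor_list C [] = \<iota>\<^bsub>C\<^esub> \<one>\<^bsub>C\<^esub>"
| "tensor_list C (f # fs) = f \<otimes>\<^bsub>C\<^esub> tensor_list C fs"

text \<open>\<open>permute_wires C A xs ys\<close> is the permutation of the factors of a tensor power of \<open>A\<close>, built
  from the braiding, that sends the factor labelled \<open>l\<close> in the source \<open>xs\<close> to the factor labelled
  \<open>l\<close> in the target \<open>ys\<close>. It is meaningful only if \<open>xs\<close> has distinct entries and \<open>ys\<close> is a
  rearrangement of \<open>xs\<close>. The recursion moves the wire \<open>y\<close> to the front past the block of wires
  preceding it and then permutes the remaining wires; by coherence of the symmetric braiding the
  choice of recursion does not matter.\<close>

fun permute_wires ::
  "('o, 'm, 'z) monoidal_data_scheme \<Rightarrow> 'o \<Rightarrow> 'l list \<Rightarrow> 'l list \<Rightarrow> 'm" where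
  "permute_wires C A xs [] = \<iota>\<^bsub>C\<^esub> (tensor_power C A (length xs))"
| "permute_wires C A xs (y # ys) =
    (let before = takeWhile (\<lambda>x. x \<noteq> y) xs; after = tl (dropWhile (\<lambda>x. x \<noteq> y) xs)
     in (\<iota>\<^bsub>C\<^esub> A \<otimes>\<^bsub>C\<^esub> permute_wires C A (before @ after) ys) \<cdot>\<^bsub>C\<^esub>
        (\<sigma>\<^bsub>C\<^esub> (tensor_power C A (length before)) A \<otimes>\<^bsub>C\<^esub>
         \<iota>\<^bsub>C\<^esub> (tensor_power C A (length after))))"

text \<open>In \<open>index_product C A ts cs outs\<close>, an entry \<open>(t, x, y, z)\<close> of \<open>ts\<close> stands for \<open>t\<^sub>x\<^sub>y\<^sub>z\<close>
  and an entry \<open>(c, x, x')\<close> of \<open>cs\<close> for \<open>c\<close> with first output \<open>x\<close> and second output \<open>x'\<close>;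
  \<open>outs\<close> lists the unmatched labels in the order in which they are the outputs of the composite.\<close>

definition index_product ::
  "('o, 'm, 'z) monoidal_data_scheme \<Rightarrow> 'o \<Rightarrow> ('m \<times> 'l \<times> 'l \<times> 'l) list
    \<Rightarrow> ('m \<times> 'l \<times> 'l) list \<Rightarrow> 'l list \<Rightarrow> 'm" where
  "index_product C A ts cs outs =
    (tensor_list C (map fst ts) \<otimes>\<^bsub>C\<^esub> \<iota>\<^bsub>C\<^esub> (tensor_power C A (length outs))) \<cdot>\<^bsub>C\<^esub>
    permute_wires C A
      (concat (map (\<lambda>(c, x, x'). [x, x']) cs))
      (concat (map (\<lambda>(t, x, y, z). [x, y, z]) ts) @ outs) \<cdot>\<^bsub>C\<^esub>
    tensor_list C (map fst cs)"

datatype label =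
    La | Lb | Lc | Ld | Lu | Lv | Lw | Lx | Ly | Lz
  | La' | Lb' | Lc' | Ld' | Lu' | Lv' | Lw' | Lx' | Ly' | Lz'

end

theory Submission
  imports Defs "HOL-Library.Multiset"
begin

text \<open>
  Since \<open>\<epsilon> (x y) = \<epsilon> (y N x)\<close>, the Nakayama automorphism \<open>N\<close> converts \<open>c\<^sub>-\<^sub>1\<close> into
  \<open>c\<^sub>1 = (id \<otimes> N) c\<^sub>-\<^sub>1\<close>; because \<open>N\<^sup>2 = id\<close>, changing the sign of any \<open>c\<close> amounts to inserting
  \<open>N\<close> at either of its outputs. Every index expression thus becomes a product of cyclic words
  \<open>\<epsilon> (N\<^sup>k\<^sup>1 x\<^sub>1 \<dots> N\<^sup>k\<^sup>n x\<^sub>n)\<close> with outer factors \<open>c\<^sub>-\<^sub>1\<close>, subject to four rules: moving a letter around the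
  word applies \<open>N\<close> to it, \<open>N\<close> may be applied to a whole word at once, contracting one letter of
  each of two words with \<open>c\<^sub>1\<close> concatenates the remaining words, and contracting two adjacent
  letters with \<open>c\<^sub>-\<^sub>1\<close> deletes them by \<open>\<Delta>\<close>-separability. Each relation compares the two words
  obtained in this way.

  Wire permutations are handled by coherence: \<open>permute_wires\<close> is functorial, takes concatenation
  of label lists to tensor products and block swaps to braidings.
\<close>

section \<open>Calculus of morphisms\<close>

context category
begin

text \<open>Turning typing into equations on \<open>Dom\<close> and \<open>Cod\<close> lets
  composability be checked by rewriting in all later calculations.\<close>

lemma hom_iff: "f \<in> hom C X Y \<longleftrightarrow> f \<in> Mor C \<and> Dom C f = X \<and> Cod C f = Y"
  by (auto simp: hom_def)

lemma Id_simps [simp]: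
  assumes "X \<in> Ob C"
  shows "\<iota> X \<in> Mor C" "Dom C (\<iota> X) = X" "Cod C (\<iota> X) = X"
  using Id_hom[OF assms] by (auto simp: hom_iff)

lemma Comp_simps [simp]:
  assumes "f \<in> Mor C" "g \<in> Mor C" "Cod C f = Dom C g"
  shows "g \<cdot> f \<in> Mor C" "Dom C (g \<cdot> f) = Dom C f" "Cod C (g \<cdot> f) = Cod C g"
  using Comp_hom[of f "Dom C f" "Cod C f" g "Cod C g"] assms by (auto simp: hom_iff)

lemma Dom_Ob [simp]: "f \<in> Mor C \<Longrightarrow> Dom C f \<in> Ob C"
  and Cod_Ob [simp]: "f \<in> Mor C \<Longrightarrow> Cod C f \<in> Ob C"
  by (auto intro: Dom_closed Cod_closed)

lemma Comp_Id [simp]: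
  "\<lbrakk>f \<in> Mor C; Cod C f = Y\<rbrakk> \<Longrightarrow> \<iota> Y \<cdot> f = f"
  "\<lbrakk>f \<in> Mor C; Dom C f = Y\<rbrakk> \<Longrightarrow> f \<cdot> \<iota> Y = f"
  by (auto intro: Comp_Id_left Comp_Id_right simp: hom_iff)

lemma Comp_assoc' [simp]:
  "\<lbrakk>f \<in> Mor C; g \<in> Mor C; h \<in> Mor C; Cod C f = Dom C g; Cod C g = Dom C h\<rbrakk>
    \<Longrightarrow> (h \<cdot> g) \<cdot> f = h \<cdot> g \<cdot> f"
  by (rule Comp_assoc) (auto simp: hom_iff)

end

context strict_monoidal_category
begin

declare Unit_Ob [simp] TensorOb_closed [simp] TensorOb_Unit_left [simp] TensorOb_Unit_right [simp]
  TensorOb_assoc [simp] TensorMor_Unit_left [simp] TensorMor_Unit_right [simp]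
  TensorMor_assoc [simp]

lemma TensorMor_simps [simp]:
  assumes "f \<in> Mor C" "g \<in> Mor C"
  shows "f \<otimes> g \<in> Mor C" "Dom C (f \<otimes> g) = Dom C f \<odot> Dom C g"
    "Cod C (f \<otimes> g) = Cod C f \<odot> Cod C g"
  using TensorMor_hom[of f "Dom C f" "Cod C f" g "Dom C g" "Cod C g"] assms
  by (auto simp: hom_iff)

lemma Id_TensorOb [simp]: "\<lbrakk>X \<in> Ob C; Y \<in> Ob C\<rbrakk> \<Longrightarrow> \<iota> (X \<odot> Y) = \<iota> X \<otimes> \<iota> Y"
  by (simp add: TensorMor_Id)

text \<open>Identities on tensor products are kept split into factors by \<open>Id_TensorOb\<close>,
  so the unit law is needed in that form: here for two factors, below for three and four.\<close>

lemma Id_Id_Comp [simp]: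
  "\<lbrakk>f \<in> Mor C; X \<in> Ob C; Y \<in> Ob C; Cod C f = X \<odot> Y\<rbrakk> \<Longrightarrow> (\<iota> X \<otimes> \<iota> Y) \<cdot> f = f"
  "\<lbrakk>f \<in> Mor C; X \<in> Ob C; Y \<in> Ob C; Dom C f = X \<odot> Y\<rbrakk> \<Longrightarrow> f \<cdot> (\<iota> X \<otimes> \<iota> Y) = f"
  using Comp_Id[of f "X \<odot> Y"] by simp_all

lemma Id3_Comp [simp]:
  "\<lbrakk>f \<in> Mor C; X \<in> Ob C; Y \<in> Ob C; Z \<in> Ob C; Cod C f = X \<odot> Y \<odot> Z\<rbrakk>
    \<Longrightarrow> (\<iota> X \<otimes> \<iota> Y \<otimes> \<iota> Z) \<cdot> f = f"
  "\<lbrakk>f \<in> Mor C; X \<in> Ob C; Y \<in> Ob C; Z \<in> Ob C; Dom C f = X \<odot> Y \<odot> Z\<rbrakk>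
    \<Longrightarrow> f \<cdot> (\<iota> X \<otimes> \<iota> Y \<otimes> \<iota> Z) = f"
  using Comp_Id[of f "X \<odot> Y \<odot> Z"] by simp_all

lemma Id4_Comp [simp]:
  "\<lbrakk>f \<in> Mor C; W \<in> Ob C; X \<in> Ob C; Y \<in> Ob C; Z \<in> Ob C; Cod C f = W \<odot> X \<odot> Y \<odot> Z\<rbrakk>
    \<Longrightarrow> (\<iota> W \<otimes> \<iota> X \<otimes> \<iota> Y \<otimes> \<iota> Z) \<cdot> f = f"
  "\<lbrakk>f \<in> Mor C; W \<in> Ob C; X \<in> Ob C; Y \<in> Ob C; Z \<in> Ob C; Dom C f = W \<odot> X \<odot> Y \<odot> Z\<rbrakk>
    \<Longrightarrow> f \<cdot> (\<iota> W \<otimes> \<iota> X \<otimes> \<iota> Y \<otimes> \<iota> Z) = f"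
  using Comp_Id[of f "W \<odot> X \<odot> Y \<odot> Z"] by simp_all

text \<open>Interchange, read as fusing two layers of parallel morphisms into one.
  \<open>tensor_comp'\<close> is the same rule with a further morphism applied before both
  layers.\<close>

lemma tensor_comp:
  "\<lbrakk>f \<in> Mor C; g \<in> Mor C; f' \<in> Mor C; g' \<in> Mor C; Cod C f = Dom C g; Cod C f' = Dom C g'\<rbrakk>
    \<Longrightarrow> (g \<otimes> g') \<cdot> (f \<otimes> f') = (g \<cdot> f) \<otimes> (g' \<cdot> f')"
  by (rule interchange[symmetric]) (auto simp: hom_iff)

lemma tensor_comp':
  "\<lbrakk>f \<in> Mor C; g \<in> Mor C; f' \<in> Mor C; g' \<in> Mor C; Cod C f = Dom C g; Cod C f' = Dom C g';
    h \<in> Mor C; Cod C h = Dom C f \<odot> Dom C f'\<rbrakk>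
    \<Longrightarrow> (g \<otimes> g') \<cdot> (f \<otimes> f') \<cdot> h = ((g \<cdot> f) \<otimes> (g' \<cdot> f')) \<cdot> h"
  using tensor_comp[of f g f' g'] Comp_assoc'[of h "f \<otimes> f'" "g \<otimes> g'"] by simp

lemma whisker:
  assumes "f \<in> Mor C" "g \<in> Mor C" "Cod C f = Dom C g" "X \<in> Ob C"
  shows whisker_right: "(g \<cdot> f) \<otimes> \<iota> X = (g \<otimes> \<iota> X) \<cdot> (f \<otimes> \<iota> X)"
    and whisker_left: "\<iota> X \<otimes> (g \<cdot> f) = (\<iota> X \<otimes> g) \<cdot> (\<iota> X \<otimes> f)"
  using assms by (simp_all add: tensor_comp)

text \<open>A morphism into the unit object leaves no wire behind, so it can be placed before or
  beside another morphism: this is interchange with \<open>\<iota> \<one>\<close>, which strictness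
  makes invisible. \<open>state_tensor\<close> is the dual rule for morphisms out of the
  unit.\<close>

lemma effect_tensor:
  assumes "f \<in> Mor C" "Cod C f = \<one>" "h \<in> Mor C"
  shows effect_tensor_left: "h \<cdot> (f \<otimes> \<iota> (Dom C h)) = f \<otimes> h"
    and effect_tensor_right: "h \<cdot> (\<iota> (Dom C h) \<otimes> f) = h \<otimes> f"
  using tensor_comp[of f "\<iota> \<one>" "\<iota> (Dom C h)" h] tensor_comp[of "\<iota> (Dom C h)" h f "\<iota> \<one>"] assms
  by simp_all

lemma state_tensor:
  assumes "c \<in> Mor C" "Dom C c = \<one>" "h \<in> Mor C"
  shows state_tensor_left: "(c \<otimes> \<iota> (Cod C h)) \<cdot> h = c \<otimes> h"
    and state_tensor_right: "(\<iota> (Cod C h) \<otimes> c) \<cdot> h = h \<otimes> c"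
  using tensor_comp[of "\<iota> \<one>" c h "\<iota> (Cod C h)"] tensor_comp[of h "\<iota> (Cod C h)" "\<iota> \<one>" c] assms
  by simp_all

lemma tensor_power_Ob [simp]: "A \<in> Ob C \<Longrightarrow> tensor_power C A n \<in> Ob C"
  by (induction n) auto

lemma tensor_power_add [simp]:
  "A \<in> Ob C \<Longrightarrow> tensor_power C A (m + n) = tensor_power C A m \<odot> tensor_power C A n"
  by (induction m) auto

end

section \<open>Derived rules for the symmetric braiding\<close>

context symmetric_strict_monoidal_category
begin

lemma Braid_simps [simp]:
  assumes "X \<in> Ob C" "Y \<in> Ob C"
  shows "\<sigma> X Y \<in> Mor C" "Dom C (\<sigma> X Y) = X \<odot> Y" "Cod C (\<sigma> X Y) = Y \<odot> X"
  using Braid_hom[OF assms] by (auto simp: hom_iff)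

lemma Braid_nat:
  "\<lbrakk>f \<in> Mor C; g \<in> Mor C; Cod C f = X; Cod C g = Y\<rbrakk>
    \<Longrightarrow> \<sigma> X Y \<cdot> (f \<otimes> g) = (g \<otimes> f) \<cdot> \<sigma> (Dom C f) (Dom C g)"
  by (rule Braid_natural) (auto simp: hom_iff)

lemma Braid_nat':
  assumes "f \<in> Mor C" "g \<in> Mor C" "Cod C f = X" "Cod C g = Y"
    and "h \<in> Mor C" "Cod C h = Dom C f \<odot> Dom C g"
  shows "\<sigma> X Y \<cdot> (f \<otimes> g) \<cdot> h = (g \<otimes> f) \<cdot> \<sigma> (Dom C f) (Dom C g) \<cdot> h"
proof -
  have [simp]: "X \<in> Ob C" "Y \<in> Ob C" using assms Cod_Ob by auto
  have "(\<sigma> X Y \<cdot> (f \<otimes> g)) \<cdot> h = ((g \<otimes> f) \<cdot> \<sigma> (Dom C f) (Dom C g)) \<cdot> h"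
    using assms(1-4) by (simp only: Braid_nat)
  then show ?thesis using assms by simp
qed

lemma Braid_inv [simp]: "\<lbrakk>X \<in> Ob C; Y \<in> Ob C\<rbrakk> \<Longrightarrow> \<sigma> Y X \<cdot> \<sigma> X Y = \<iota> X \<otimes> \<iota> Y"
  by (simp add: Braid_symmetric)

lemma Braid_inv' [simp]:
  "\<lbrakk>X \<in> Ob C; Y \<in> Ob C; h \<in> Mor C; Cod C h = X \<odot> Y\<rbrakk> \<Longrightarrow> \<sigma> Y X \<cdot> \<sigma> X Y \<cdot> h = h"
  using Comp_assoc'[of h "\<sigma> X Y" "\<sigma> Y X"] by simp

text \<open>The hexagon at two copies of \<open>\<one>\<close> makes
  \<open>\<sigma> X \<one>\<close> idempotent; being invertible by symmetry, it is the
  identity.\<close>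

lemma Braid_Unit_right [simp]:
  assumes X: "X \<in> Ob C" shows "\<sigma> X \<one> = \<iota> X"
proof -
  have "\<sigma> X \<one> = \<sigma> X \<one> \<cdot> \<sigma> X \<one>"
    using Braid_hexagon[OF X Unit_Ob Unit_Ob] X by simp
  then have "\<sigma> \<one> X \<cdot> \<sigma> X \<one> = \<sigma> \<one> X \<cdot> \<sigma> X \<one> \<cdot> \<sigma> X \<one>" by simp
  then show ?thesis using X by (simp del: Braid_inv add: Braid_symmetric)
qed

lemma Braid_Unit_left [simp]: "X \<in> Ob C \<Longrightarrow> \<sigma> \<one> X = \<iota> X"
  using Braid_symmetric[of X \<one>] by (simp del: Braid_inv)

text \<open>The second hexagon. The composite \<open>?g\<close> is a right inverse of
  \<open>\<sigma> Z (X \<odot> Y)\<close>, and so is \<open>\<sigma> (X \<odot> Y) Z\<close>;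
  invertibility makes them equal.\<close>

lemma Braid_hexagon_left:
  assumes [simp]: "X \<in> Ob C" "Y \<in> Ob C" "Z \<in> Ob C"
  shows "\<sigma> (X \<odot> Y) Z = (\<sigma> X Z \<otimes> \<iota> Y) \<cdot> (\<iota> X \<otimes> \<sigma> Y Z)"
proof -
  let ?g = "(\<sigma> X Z \<otimes> \<iota> Y) \<cdot> (\<iota> X \<otimes> \<sigma> Y Z)"
  have "\<sigma> Z (X \<odot> Y) \<cdot> ?g = \<iota> (X \<odot> (Y \<odot> Z))"
    by (simp add: Braid_hexagon tensor_comp tensor_comp')
  then have "\<sigma> (X \<odot> Y) Z \<cdot> \<sigma> Z (X \<odot> Y) \<cdot> ?g = \<sigma> (X \<odot> Y) Z \<cdot> \<iota> (X \<odot> (Y \<odot> Z))"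
    by simp
  then show ?thesis by (simp del: Id_TensorOb)
qed

end

section \<open>Permutations of wires\<close>

locale wires = symmetric_strict_monoidal_category C
  for C :: "('o, 'm, 'z) monoidal_data_scheme" (structure) +
  fixes A :: 'o
  assumes A_Ob' [simp]: "A \<in> Ob C"
begin

abbreviation pow :: "'l list \<Rightarrow> 'o" where
  "pow xs \<equiv> tensor_power C A (length xs)"

abbreviation perm :: "'l list \<Rightarrow> 'l list \<Rightarrow> 'm" where
  "perm \<equiv> permute_wires C A"

declare length_append [simp del]

lemma pow_append [simp]: "pow (xs @ ys) = pow xs \<odot> pow ys"
  by (simp add: length_append)

text \<open>Replaces \<open>takeWhile\<close> and \<open>dropWhile\<close> by an explicit splitting
  of the source, the form in which the inductions below peel off a target label.\<close>

lemma perm_Cons: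
  assumes "y \<notin> set P"
  shows "perm (P @ y # Q) (y # ys) =
    (\<iota> A \<otimes> perm (P @ Q) ys) \<cdot> (\<sigma> (pow P) A \<otimes> \<iota> (pow Q))"
proof -
  have "takeWhile (\<lambda>x. x \<noteq> y) (P @ y # Q) = P" "dropWhile (\<lambda>x. x \<noteq> y) (P @ y # Q) = y # Q"
    using assms by (induction P) auto
  then show ?thesis by simp
qed

lemma perm_Cons_same [simp]: "perm (y # xs) (y # ys) = \<iota> A \<otimes> perm xs ys"
  if "perm xs ys \<in> Mor C" "Dom C (perm xs ys) = pow xs"
  using perm_Cons[of y "[]" xs ys] that by (simp del: permute_wires.simps add: tensor_comp)

lemma mset_Cons_splitE:
  assumes "mset xs = mset (y # ys)"
  obtains P Q where "xs = P @ y # Q" "y \<notin> set P" "mset (P @ Q) = mset ys"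
proof -
  have "y \<in> set xs" using assms by (metis list.set_intros(1) mset_eq_setD)
  then obtain P Q where "xs = P @ y # Q" "y \<notin> set P" by (meson split_list_first)
  with assms that show thesis by simp
qed

declare permute_wires.simps(2) [simp del]

lemma perm_simps [simp]:
  assumes "mset xs = mset ys"
  shows "perm xs ys \<in> Mor C" "Dom C (perm xs ys) = pow xs" "Cod C (perm xs ys) = pow ys"
proof -
  have "perm xs ys \<in> Mor C \<and> Dom C (perm xs ys) = pow xs \<and> Cod C (perm xs ys) = pow ys"
    using assms
  proof (induction ys arbitrary: xs)
    case (Cons y ys)
    obtain P Q where *: "xs = P @ y # Q" "y \<notin> set P" "mset (P @ Q) = mset ys"
      using Cons.prems by (rule mset_Cons_splitE)
    then have "pow (P @ Q) = pow ys" by (metis mset_eq_length)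
    then show ?case using Cons.IH[OF *(3)] * by (simp add: perm_Cons)
  qed simp
  then show "perm xs ys \<in> Mor C" "Dom C (perm xs ys) = pow xs" "Cod C (perm xs ys) = pow ys"
    by auto
qed

lemma perm_refl [simp]: "perm xs xs = \<iota> (pow xs)"
  by (induction xs) simp_all

text \<open>Of two marked wires, fetching the left one first, then the right one, and swapping them
  agrees with fetching the right one first. The right wire crosses its block naturally with respect
  to rearranging that block, and the hexagon splits its crossing of the rearranged block.\<close>

lemma bring_exchange:
  fixes P Q R :: "'l list"
  shows "(\<sigma> A A \<otimes> \<iota> (pow (P @ Q @ R))) \<cdot> (\<iota> A \<otimes> \<sigma> (pow (P @ Q)) A \<otimes> \<iota> (pow R)) \<cdot>
      (\<sigma> (pow P) A \<otimes> \<iota> (pow Q) \<otimes> \<iota> A \<otimes> \<iota> (pow R))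
    = (\<iota> A \<otimes> \<sigma> (pow P) A \<otimes> \<iota> (pow (Q @ R))) \<cdot>
      (\<sigma> (pow P \<odot> A \<odot> pow Q) A \<otimes> \<iota> (pow R))"
proof -
  let ?p = "pow P" and ?q = "pow Q" and ?r = "pow R"
  have "\<sigma> (A \<odot> ?p \<odot> ?q) A \<cdot> ((\<sigma> ?p A \<otimes> \<iota> ?q) \<otimes> \<iota> A)
      = (\<iota> A \<otimes> \<sigma> ?p A \<otimes> \<iota> ?q) \<cdot> \<sigma> (?p \<odot> A \<odot> ?q) A"
    by (subst Braid_nat) simp_all
  then have "(\<sigma> (A \<odot> ?p \<odot> ?q) A \<cdot> (\<sigma> ?p A \<otimes> \<iota> ?q \<otimes> \<iota> A)) \<otimes> \<iota> ?r
      = ((\<iota> A \<otimes> \<sigma> ?p A \<otimes> \<iota> ?q) \<cdot> \<sigma> (?p \<odot> A \<odot> ?q) A) \<otimes> \<iota> ?r"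
    by simp
  moreover have "(\<sigma> (A \<odot> ?p \<odot> ?q) A \<cdot> (\<sigma> ?p A \<otimes> \<iota> ?q \<otimes> \<iota> A)) \<otimes> \<iota> ?r
    = (\<sigma> (A \<odot> ?p \<odot> ?q) A \<otimes> \<iota> ?r) \<cdot> ((\<sigma> ?p A \<otimes> \<iota> ?q \<otimes> \<iota> A) \<otimes> \<iota> ?r)"
    by (subst tensor_comp) simp_all
  moreover have "((\<iota> A \<otimes> \<sigma> ?p A \<otimes> \<iota> ?q) \<cdot> \<sigma> (?p \<odot> A \<odot> ?q) A) \<otimes> \<iota> ?r
    = ((\<iota> A \<otimes> \<sigma> ?p A \<otimes> \<iota> ?q) \<otimes> \<iota> ?r) \<cdot> (\<sigma> (?p \<odot> A \<odot> ?q) A \<otimes> \<iota> ?r)"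
    by (subst tensor_comp) simp_all
  moreover have "\<sigma> (A \<odot> ?p \<odot> ?q) A \<otimes> \<iota> ?r
    = (\<sigma> A A \<otimes> \<iota> (pow (P @ Q @ R))) \<cdot> (\<iota> A \<otimes> \<sigma> (pow (P @ Q)) A \<otimes> \<iota> (pow R))"
  proof -
    have "\<sigma> (A \<odot> ?p \<odot> ?q) A \<otimes> \<iota> ?r
      = ((\<sigma> A A \<otimes> \<iota> ?p \<otimes> \<iota> ?q) \<cdot> (\<iota> A \<otimes> \<sigma> (?p \<odot> ?q) A)) \<otimes> (\<iota> ?r \<cdot> \<iota> ?r)"
      using Braid_hexagon_left[of A "?p \<odot> ?q" A] by simp
    also have "\<dots> = ((\<sigma> A A \<otimes> \<iota> ?p \<otimes> \<iota> ?q) \<otimes> \<iota> ?r) \<cdot> ((\<iota> A \<otimes> \<sigma> (?p \<odot> ?q) A) \<otimes> \<iota> ?r)"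
      by (subst tensor_comp) simp_all
    finally show ?thesis by simp
  qed
  ultimately show ?thesis by simp
qed

lemma braid_slide:
  assumes [simp]: "f \<in> Mor C" "h \<in> Mor C" "Cod C h = A \<odot> A \<odot> Dom C f" "Cod C f = X"
  shows "(\<sigma> A A \<otimes> \<iota> X) \<cdot> (\<iota> A \<otimes> \<iota> A \<otimes> f) \<cdot> h = (\<iota> A \<otimes> \<iota> A \<otimes> f) \<cdot> (\<sigma> A A \<otimes> \<iota> (Dom C f)) \<cdot> h"
proof -
  have [simp]: "X \<in> Ob C" using assms(2) \<open>Cod C f = X\<close> Cod_Ob[of f] by auto
  have "(\<sigma> A A \<otimes> \<iota> X) \<cdot> ((\<iota> A \<otimes> \<iota> A) \<otimes> f) = ((\<iota> A \<otimes> \<iota> A) \<otimes> f) \<cdot> (\<sigma> A A \<otimes> \<iota> (Dom C f))"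
    by (subst (1 2) tensor_comp) (simp_all del: TensorMor_assoc)
  then have "(\<sigma> A A \<otimes> \<iota> X) \<cdot> (\<iota> A \<otimes> \<iota> A \<otimes> f) = (\<iota> A \<otimes> \<iota> A \<otimes> f) \<cdot> (\<sigma> A A \<otimes> \<iota> (Dom C f))"
    by simp
  then have "((\<sigma> A A \<otimes> \<iota> X) \<cdot> (\<iota> A \<otimes> \<iota> A \<otimes> f)) \<cdot> h
      = ((\<iota> A \<otimes> \<iota> A \<otimes> f) \<cdot> (\<sigma> A A \<otimes> \<iota> (Dom C f))) \<cdot> h" by simp
  then show ?thesis by simp
qed

text \<open>The core of coherence: the wire \<open>z\<close> may be fetched to the front before or
  after the other wires are permuted. The induction peels off the first target wire
  \<open>y\<close>, and \<open>bring_exchange\<close> compares the two orders in which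
  \<open>y\<close> and \<open>z\<close> are fetched.\<close>

lemma perm_bring:
  assumes "mset (P @ z # Q) = mset (P' @ z # Q')" "distinct (P @ z # Q)"
  shows "(\<sigma> (pow P') A \<otimes> \<iota> (pow Q')) \<cdot> perm (P @ z # Q) (P' @ z # Q') =
    (\<iota> A \<otimes> perm (P @ Q) (P' @ Q')) \<cdot> (\<sigma> (pow P) A \<otimes> \<iota> (pow Q))"
  using assms
proof (induction P' arbitrary: P Q)
  case Nil
  then show ?case by (simp add: perm_Cons)
next
  case (Cons y P')
  let ?R = "P' @ Q'"
  let ?b = "\<lambda>P Q. \<sigma> (pow P) A \<otimes> \<iota> (pow Q)"
  have neq: "y \<noteq> z" using Cons.prems
    by (metis append_Cons distinct.simps(2) in_set_conv_decomp mset_eq_imp_distinct_iff)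
  have "y \<in> set (P @ z # Q)" using Cons.prems by (metis append_Cons list.set_intros(1) mset_eq_setD)
  then consider "y \<in> set P" | "y \<in> set Q" using neq by auto
  then show ?case
  proof cases
    case 1
    then obtain P1 P2 where P: "P = P1 @ y # P2" by (meson split_list)
    have ms: "mset (P1 @ P2 @ z # Q) = mset (P' @ z # Q')" "mset (P1 @ P2 @ Q) = mset ?R"
      using Cons.prems P by auto
    have d: "distinct ((P1 @ P2) @ z # Q)" "y \<notin> set P1" using Cons.prems P by auto
    note IH = Cons.IH[of "P1 @ P2" Q, simplified append_assoc, OF ms(1) d(1)[simplified append_assoc]]
    have len: "pow (P1 @ P2 @ Q) = pow ?R" "pow (P1 @ P2 @ z # Q) = pow (P' @ z # Q')"
      using ms by (metis mset_eq_length)+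
    have 1: "perm (P @ z # Q) ((y # P') @ z # Q') =
        (\<iota> A \<otimes> perm (P1 @ P2 @ z # Q) (P' @ z # Q')) \<cdot> ?b P1 (P2 @ z # Q)"
      using perm_Cons[OF d(2), of "P2 @ z # Q" "P' @ z # Q'"] P by simp
    have 2: "perm (P @ Q) ((y # P') @ Q') =
        (\<iota> A \<otimes> perm (P1 @ P2 @ Q) (P' @ Q')) \<cdot> ?b P1 (P2 @ Q)"
      using perm_Cons[OF d(2), of "P2 @ Q" "P' @ Q'"] P by simp
    have 3: "?b (y # P') Q' = (\<sigma> A A \<otimes> \<iota> (pow ?R)) \<cdot> (\<iota> A \<otimes> ?b P' Q')"
      using Braid_hexagon_left[of A "pow P'" A] by (simp add: whisker_right)
    have "?b (y # P') Q' \<cdot> perm (P @ z # Q) ((y # P') @ z # Q')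
      = (\<sigma> A A \<otimes> \<iota> (pow ?R)) \<cdot>
        (\<iota> A \<otimes> (?b P' Q' \<cdot> perm (P1 @ P2 @ z # Q) (P' @ z # Q'))) \<cdot> ?b P1 (P2 @ z # Q)"
      unfolding 1 3 using ms len by (simp add: tensor_comp tensor_comp')
    also have "\<dots> = (\<sigma> A A \<otimes> \<iota> (pow ?R)) \<cdot>
        (\<iota> A \<otimes> \<iota> A \<otimes> perm (P1 @ P2 @ Q) ?R) \<cdot>
        (\<iota> A \<otimes> ?b (P1 @ P2) Q) \<cdot> ?b P1 (P2 @ z # Q)"
      unfolding IH using ms len by (simp add: tensor_comp tensor_comp')
    also have "\<dots> = (\<iota> A \<otimes> \<iota> A \<otimes> perm (P1 @ P2 @ Q) ?R) \<cdot>
        (\<sigma> A A \<otimes> \<iota> (pow (P1 @ P2 @ Q))) \<cdot>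
        (\<iota> A \<otimes> ?b (P1 @ P2) Q) \<cdot> ?b P1 (P2 @ z # Q)"
      by (subst braid_slide) (use ms len in simp_all)
    also have "\<dots> = (\<iota> A \<otimes> \<iota> A \<otimes> perm (P1 @ P2 @ Q) ?R) \<cdot>
        (\<iota> A \<otimes> ?b P1 (P2 @ Q)) \<cdot> ?b P Q"
      using bring_exchange[of P1 P2 Q] P by simp
    also have "\<dots> = (\<iota> A \<otimes> perm (P @ Q) ((y # P') @ Q')) \<cdot> ?b P Q"
      unfolding 2 using P ms len by (simp add: tensor_comp tensor_comp')
    finally show ?thesis .
  next
    case 2
    then obtain Q1 Q2 where Q: "Q = Q1 @ y # Q2" by (meson split_list)
    have ms: "mset (P @ z # Q1 @ Q2) = mset (P' @ z # Q')" "mset (P @ Q1 @ Q2) = mset ?R"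
      using Cons.prems Q by auto
    have d: "distinct (P @ z # Q1 @ Q2)" "y \<notin> set (P @ z # Q1)" "y \<notin> set (P @ Q1)"
      using Cons.prems Q by auto
    note IH = Cons.IH[OF ms(1) d(1)]
    have len: "pow (P @ Q1 @ Q2) = pow ?R" "pow (P @ z # Q1 @ Q2) = pow (P' @ z # Q')"
      using ms by (metis mset_eq_length)+
    have 1: "perm (P @ z # Q) ((y # P') @ z # Q') =
        (\<iota> A \<otimes> perm (P @ z # Q1 @ Q2) (P' @ z # Q')) \<cdot> ?b (P @ z # Q1) Q2"
      using perm_Cons[OF d(2), of Q2 "P' @ z # Q'"] Q by simp
    have 2: "perm (P @ Q) ((y # P') @ Q') =
        (\<iota> A \<otimes> perm (P @ Q1 @ Q2) (P' @ Q')) \<cdot> ?b (P @ Q1) Q2"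
      using perm_Cons[OF d(3), of Q2 "P' @ Q'"] Q by simp
    have 3: "?b (y # P') Q' = (\<sigma> A A \<otimes> \<iota> (pow ?R)) \<cdot> (\<iota> A \<otimes> ?b P' Q')"
      using Braid_hexagon_left[of A "pow P'" A] by (simp add: whisker_right)
    \<comment> \<open>Now \<open>y\<close> lies to the right of \<open>z\<close>, so
      \<open>bring_exchange\<close> is used with the roles of the two wires exchanged; the resulting
      second swap cancels the first by symmetry.\<close>
    have 4: "(\<sigma> A A \<otimes> \<iota> (pow (P @ Q1 @ Q2))) \<cdot> (\<iota> A \<otimes> ?b P (Q1 @ Q2)) \<cdot> ?b (P @ z # Q1) Q2
      = (\<iota> A \<otimes> ?b (P @ Q1) Q2) \<cdot> ?b P Q"
    proof -
      have "(\<sigma> A A \<otimes> \<iota> (pow (P @ Q1 @ Q2))) \<cdot> (\<iota> A \<otimes> ?b P (Q1 @ Q2)) \<cdot> ?b (P @ z # Q1) Q2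
        = (\<sigma> A A \<otimes> \<iota> (pow (P @ Q1 @ Q2))) \<cdot> (\<sigma> A A \<otimes> \<iota> (pow (P @ Q1 @ Q2))) \<cdot>
          (\<iota> A \<otimes> ?b (P @ Q1) Q2) \<cdot> ?b P Q"
        using bring_exchange[of P Q1 Q2] Q by simp
      then show ?thesis using Q by (simp add: tensor_comp tensor_comp')
    qed
    have "?b (y # P') Q' \<cdot> perm (P @ z # Q) ((y # P') @ z # Q')
      = (\<sigma> A A \<otimes> \<iota> (pow ?R)) \<cdot>
        (\<iota> A \<otimes> (?b P' Q' \<cdot> perm (P @ z # Q1 @ Q2) (P' @ z # Q'))) \<cdot> ?b (P @ z # Q1) Q2"
      unfolding 1 3 using ms len by (simp add: tensor_comp tensor_comp')
    also have "\<dots> = (\<sigma> A A \<otimes> \<iota> (pow ?R)) \<cdot>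
        (\<iota> A \<otimes> \<iota> A \<otimes> perm (P @ Q1 @ Q2) ?R) \<cdot>
        (\<iota> A \<otimes> ?b P (Q1 @ Q2)) \<cdot> ?b (P @ z # Q1) Q2"
      unfolding IH using ms len by (simp add: tensor_comp tensor_comp')
    also have "\<dots> = (\<iota> A \<otimes> \<iota> A \<otimes> perm (P @ Q1 @ Q2) ?R) \<cdot>
        (\<sigma> A A \<otimes> \<iota> (pow (P @ Q1 @ Q2))) \<cdot>
        (\<iota> A \<otimes> ?b P (Q1 @ Q2)) \<cdot> ?b (P @ z # Q1) Q2"
      by (subst braid_slide) (use ms len in simp_all)
    also have "\<dots> = (\<iota> A \<otimes> \<iota> A \<otimes> perm (P @ Q1 @ Q2) ?R) \<cdot>
        (\<iota> A \<otimes> ?b (P @ Q1) Q2) \<cdot> ?b P Q"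
      unfolding 4 ..
    also have "\<dots> = (\<iota> A \<otimes> perm (P @ Q) ((y # P') @ Q')) \<cdot> ?b P Q"
      unfolding 2 using Q ms len by (simp add: tensor_comp tensor_comp')
    finally show ?thesis .
  qed
qed

text \<open>Independence of the intermediate order. For the first final label \<open>z\<close>,
  \<open>perm_bring\<close> moves its extraction from the middle list back to the source list, and
  the induction hypothesis composes the permutations of the remaining wires.\<close>

lemma perm_comp:
  assumes "mset xs = mset ys" "mset ys = mset zs" "distinct xs"
  shows "perm ys zs \<cdot> perm xs ys = perm xs zs"
  using assms
proof (induction zs arbitrary: xs ys)
  case Nil
  then show ?case by simp
next
  case (Cons z zs)
  obtain P Q where xs: "xs = P @ z # Q" "z \<notin> set P" "mset (P @ Q) = mset zs"
    using mset_Cons_splitE[of xs z zs] Cons.prems by metis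
  obtain P' Q' where ys: "ys = P' @ z # Q'" "z \<notin> set P'" "mset (P' @ Q') = mset zs"
    using mset_Cons_splitE[of ys z zs] Cons.prems by metis
  have ms: "mset (P @ Q) = mset (P' @ Q')" "distinct (P @ Q)" using xs ys Cons.prems by auto
  have len: "pow (P @ Q) = pow zs" "pow (P' @ Q') = pow zs" using xs ys by (metis mset_eq_length)+
  let ?b = "\<lambda>P Q. \<sigma> (pow P) A \<otimes> \<iota> (pow Q)"
  have "perm ys (z # zs) \<cdot> perm xs ys = ((\<iota> A \<otimes> perm (P' @ Q') zs) \<cdot> ?b P' Q') \<cdot> perm xs ys"
    using perm_Cons[OF ys(2)] ys by simp
  also have "\<dots> = (\<iota> A \<otimes> perm (P' @ Q') zs) \<cdot> ?b P' Q' \<cdot> perm xs ys"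
    using ys xs Cons.prems len by simp
  also have "\<dots> = (\<iota> A \<otimes> perm (P' @ Q') zs) \<cdot> (\<iota> A \<otimes> perm (P @ Q) (P' @ Q')) \<cdot> ?b P Q"
    using perm_bring[of P z Q P' Q'] Cons.prems xs ys by simp
  also have "\<dots> = (\<iota> A \<otimes> (perm (P' @ Q') zs \<cdot> perm (P @ Q) (P' @ Q'))) \<cdot> ?b P Q"
    using ms len ys by (simp add: tensor_comp')
  also have "\<dots> = perm xs (z # zs)"
    using Cons.IH[OF ms(1) ys(3) ms(2)] perm_Cons[OF xs(2)] xs by simp
  finally show ?case .
qed

lemma perm_comp':
  assumes "mset xs = mset ys" "mset ys = mset zs" "distinct xs" "h \<in> Mor C" "Cod C h = pow xs"
  shows "perm ys zs \<cdot> perm xs ys \<cdot> h = perm xs zs \<cdot> h"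
  using perm_comp[OF assms(1-3)] Comp_assoc'[of h "perm xs ys" "perm ys zs"] assms by simp

lemma perm_append:
  assumes "mset xs1 = mset ys1" "mset xs2 = mset ys2"
  shows "perm (xs1 @ xs2) (ys1 @ ys2) = perm xs1 ys1 \<otimes> perm xs2 ys2"
  using assms
proof (induction ys1 arbitrary: xs1)
  case Nil
  then show ?case by simp
next
  case (Cons y ys)
  obtain P Q where xs: "xs1 = P @ y # Q" "y \<notin> set P" "mset (P @ Q) = mset ys"
    using Cons.prems(1) by (rule mset_Cons_splitE)
  have len: "pow (P @ Q) = pow ys" "pow xs2 = pow ys2" using xs Cons.prems by (metis mset_eq_length)+
  have "perm (xs1 @ xs2) ((y # ys) @ ys2)
    = (\<iota> A \<otimes> perm (P @ Q) ys \<otimes> perm xs2 ys2) \<cdot> (\<sigma> (pow P) A \<otimes> \<iota> (pow Q) \<otimes> \<iota> (pow xs2))"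
    using perm_Cons[OF xs(2), of "Q @ xs2" "ys @ ys2"] xs Cons.IH[OF xs(3)] Cons.prems by simp
  also have "\<dots> = ((\<iota> A \<otimes> perm (P @ Q) ys) \<otimes> perm xs2 ys2) \<cdot> ((\<sigma> (pow P) A \<otimes> \<iota> (pow Q)) \<otimes> \<iota> (pow xs2))"
    using xs Cons.prems by simp
  also have "\<dots> = ((\<iota> A \<otimes> perm (P @ Q) ys) \<cdot> (\<sigma> (pow P) A \<otimes> \<iota> (pow Q))) \<otimes> perm xs2 ys2"
    using xs Cons.prems len by (subst tensor_comp) simp_all
  finally show ?case using perm_Cons[OF xs(2)] xs by simp
qed

text \<open>The recursion of \<open>permute_wires\<close> on a block swap is exactly the hexagon
  identity, applied to one wire of the second block at a time.\<close>

lemma perm_swap: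
  assumes "distinct (xs @ ys)"
  shows "perm (xs @ ys) (ys @ xs) = \<sigma> (pow xs) (pow ys)"
  using assms
proof (induction ys)
  case Nil
  then show ?case by simp
next
  case (Cons y ys)
  have "perm (xs @ y # ys) (y # ys @ xs)
    = (\<iota> A \<otimes> \<sigma> (pow xs) (pow ys)) \<cdot> (\<sigma> (pow xs) A \<otimes> \<iota> (pow ys))"
    using Cons perm_Cons[of y xs ys "ys @ xs"] by simp
  then show ?case using Braid_hexagon[of "pow xs" A "pow ys"] by simp
qed

end

section \<open>The Nakayama automorphism\<close>

locale symmetric_frobenius_algebra =
  symmetric_strict_monoidal_category C + frobenius_algebra C A \<mu> \<eta> \<Delta> \<epsilon>
  for C :: "('o, 'm, 'z) monoidal_data_scheme" (structure) and A \<mu> \<eta> \<Delta> \<epsilon>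
begin

sublocale wires C A
  by unfold_locales (rule A_Ob)

lemma mult_simps [simp]: "\<mu> \<in> Mor C" "Dom C \<mu> = A \<odot> A" "Cod C \<mu> = A"
  and unit_simps [simp]: "\<eta> \<in> Mor C" "Dom C \<eta> = \<one>" "Cod C \<eta> = A"
  and comult_simps [simp]: "\<Delta> \<in> Mor C" "Dom C \<Delta> = A" "Cod C \<Delta> = A \<odot> A"
  and counit_simps [simp]: "\<epsilon> \<in> Mor C" "Dom C \<epsilon> = A" "Cod C \<epsilon> = \<one>"
  using mult_hom unit_hom comult_hom counit_hom by (simp_all add: hom_iff)

section \<open>The Frobenius pairing and copairing\<close>

definition b :: 'm where "b = \<epsilon> \<cdot> \<mu>"

definition copair :: 'm where "copair = \<Delta> \<cdot> \<eta>"

abbreviation N :: 'm where "N \<equiv> nakayama C A \<mu> \<eta> \<Delta> \<epsilon>"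

lemma b_simps [simp]: "b \<in> Mor C" "Dom C b = A \<odot> A" "Cod C b = \<one>"
  by (simp_all add: b_def)

lemma copair_simps [simp]: "copair \<in> Mor C" "Dom C copair = \<one>" "Cod C copair = A \<odot> A"
  by (simp_all add: copair_def)

lemma N_eq: "N = (b \<otimes> \<iota> A) \<cdot> (\<iota> A \<otimes> \<sigma> A A) \<cdot> (\<iota> A \<otimes> copair)"
  by (simp add: nakayama_def b_def copair_def Let_def)

lemma N_simps [simp]: "N \<in> Mor C" "Dom C N = A" "Cod C N = A"
  by (simp_all add: N_eq)

text \<open>A snake identity, exhibiting \<open>A\<close> as its own dual: the Frobenius relation
  turns the composite into \<open>\<Delta> \<cdot> \<mu>\<close> with a unit plugged in and a counit
  attached, and both cancel. \<open>zigzag_right\<close> is its mirror image.\<close>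

lemma zigzag_left: "(b \<otimes> \<iota> A) \<cdot> (\<iota> A \<otimes> copair) = \<iota> A"
proof -
  have "(b \<otimes> \<iota> A) \<cdot> (\<iota> A \<otimes> copair)
    = (\<epsilon> \<otimes> \<iota> A) \<cdot> ((\<mu> \<otimes> \<iota> A) \<cdot> (\<iota> A \<otimes> \<Delta>)) \<cdot> (\<iota> A \<otimes> \<eta>)"
    by (simp add: b_def copair_def whisker_left whisker_right)
  also have "\<dots> = ((\<epsilon> \<otimes> \<iota> A) \<cdot> \<Delta>) \<cdot> \<mu> \<cdot> (\<iota> A \<otimes> \<eta>)"
    unfolding frobenius_right by simp
  finally show ?thesis by (simp add: comult_counit_left mult_unit_right)
qed

lemma zigzag_right: "(\<iota> A \<otimes> b) \<cdot> (copair \<otimes> \<iota> A) = \<iota> A"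
proof -
  have "(\<iota> A \<otimes> b) \<cdot> (copair \<otimes> \<iota> A)
    = (\<iota> A \<otimes> \<epsilon>) \<cdot> ((\<iota> A \<otimes> \<mu>) \<cdot> (\<Delta> \<otimes> \<iota> A)) \<cdot> (\<eta> \<otimes> \<iota> A)"
    by (simp add: b_def copair_def whisker_left whisker_right)
  also have "\<dots> = ((\<iota> A \<otimes> \<epsilon>) \<cdot> \<Delta>) \<cdot> \<mu> \<cdot> (\<eta> \<otimes> \<iota> A)"
    unfolding frobenius_left by simp
  finally show ?thesis by (simp add: comult_counit_right mult_unit_left)
qed

text \<open>By naturality a wire can be pulled across the pairing at the cost of two crossings, one
  of which cancels.\<close>

lemma b_past_braid: "(b \<otimes> \<iota> A) \<cdot> (\<iota> A \<otimes> \<sigma> A A) = (\<iota> A \<otimes> b) \<cdot> (\<sigma> A A \<otimes> \<iota> A)"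
proof -
  have "b \<otimes> \<iota> A = (\<iota> A \<otimes> b) \<cdot> \<sigma> (A \<odot> A) A"
    using Braid_nat[of b "\<iota> A" \<one> A] by simp
  then show ?thesis by (simp add: Braid_hexagon_left tensor_comp)
qed

text \<open>Bending the first argument of the pairing back with \<open>copair\<close> recovers a
  morphism from its pairings. Identities for \<open>N\<close> can therefore be tested against
  \<open>b\<close>.\<close>

lemma b_nondegenerate:
  assumes "f \<in> Mor C" "g \<in> Mor C" "Dom C f = Dom C g" "Cod C f = A" "Cod C g = A"
    and "b \<cdot> (\<iota> A \<otimes> f) = b \<cdot> (\<iota> A \<otimes> g)"
  shows "f = g"
proof -
  have *: "(\<iota> A \<otimes> b) \<cdot> (\<iota> A \<otimes> \<iota> A \<otimes> h) \<cdot> (copair \<otimes> \<iota> (Dom C h)) = h"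
    if [simp]: "h \<in> Mor C" "Cod C h = A" for h
  proof -
    have "((\<iota> A \<otimes> \<iota> A) \<otimes> h) \<cdot> (copair \<otimes> \<iota> (Dom C h)) = (copair \<otimes> \<iota> A) \<cdot> h"
      using state_tensor_left[of copair h] by (subst tensor_comp) simp_all
    then have "(\<iota> A \<otimes> b) \<cdot> (\<iota> A \<otimes> \<iota> A \<otimes> h) \<cdot> (copair \<otimes> \<iota> (Dom C h))
      = ((\<iota> A \<otimes> b) \<cdot> (copair \<otimes> \<iota> A)) \<cdot> h" by simp
    then show ?thesis unfolding zigzag_right by simp
  qed
  have "f = (\<iota> A \<otimes> (b \<cdot> (\<iota> A \<otimes> f))) \<cdot> (copair \<otimes> \<iota> (Dom C f))"
    using *[of f] assms(1-5) by (simp add: whisker_left)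
  also have "\<dots> = (\<iota> A \<otimes> (b \<cdot> (\<iota> A \<otimes> g))) \<cdot> (copair \<otimes> \<iota> (Dom C g))"
    using assms by simp
  also have "\<dots> = g"
    using *[of g] assms(1-5) by (simp add: whisker_left)
  finally show ?thesis .
qed

text \<open>Redraws two crossed pairings as nested ones; the inner pairing can then meet a copairing
  and be straightened by a snake identity.\<close>

lemma b_b_middle_braid:
  "(b \<otimes> b) \<cdot> (\<iota> A \<otimes> \<sigma> A A \<otimes> \<iota> A) = b \<cdot> (\<iota> A \<otimes> b \<otimes> \<iota> A) \<cdot> (\<sigma> A A \<otimes> \<iota> A \<otimes> \<iota> A)"
proof -
  have "(b \<otimes> b) \<cdot> (\<iota> A \<otimes> \<sigma> A A \<otimes> \<iota> A) = b \<cdot> (b \<otimes> \<iota> A \<otimes> \<iota> A) \<cdot> (\<iota> A \<otimes> \<sigma> A A \<otimes> \<iota> A)"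
    using effect_tensor_left[of b b] by (subst Comp_assoc'[symmetric]) simp_all
  also have "(b \<otimes> \<iota> A \<otimes> \<iota> A) \<cdot> (\<iota> A \<otimes> \<sigma> A A \<otimes> \<iota> A) = ((b \<otimes> \<iota> A) \<cdot> (\<iota> A \<otimes> \<sigma> A A)) \<otimes> \<iota> A"
    by (simp add: whisker_right)
  also have "\<dots> = (\<iota> A \<otimes> b \<otimes> \<iota> A) \<cdot> (\<sigma> A A \<otimes> \<iota> A \<otimes> \<iota> A)"
    unfolding b_past_braid by (simp add: whisker_right)
  finally show ?thesis .
qed

text \<open>The characteristic property of \<open>N\<close>, in element notation
  \<open>b(x, N y) = b(y, x)\<close>. Unfolding \<open>N\<close> produces two crossed pairings; once
  they are nested, the copairing inside \<open>N\<close> straightens out.\<close>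

lemma b_N: "b \<cdot> (\<iota> A \<otimes> N) = b \<cdot> \<sigma> A A"
proof -
  have "b \<cdot> (\<iota> A \<otimes> N) = b \<cdot> (\<iota> A \<otimes> (((b \<otimes> \<iota> A) \<cdot> (\<iota> A \<otimes> \<sigma> A A)) \<cdot> (\<iota> A \<otimes> copair)))"
    by (simp add: N_eq)
  also have "\<dots> = b \<cdot> (\<iota> A \<otimes> \<iota> A \<otimes> b) \<cdot> (\<iota> A \<otimes> \<sigma> A A \<otimes> \<iota> A) \<cdot> (\<iota> A \<otimes> \<iota> A \<otimes> copair)"
    unfolding b_past_braid by (simp add: whisker_left)
  also have "\<dots> = ((b \<otimes> b) \<cdot> (\<iota> A \<otimes> \<sigma> A A \<otimes> \<iota> A)) \<cdot> (\<iota> A \<otimes> \<iota> A \<otimes> copair)"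
    using effect_tensor_right[of b b] by (subst Comp_assoc'[symmetric]) simp_all
  also have "\<dots> = b \<cdot> (\<iota> A \<otimes> b \<otimes> \<iota> A) \<cdot> (\<sigma> A A \<otimes> \<iota> A \<otimes> \<iota> A) \<cdot> (\<iota> A \<otimes> \<iota> A \<otimes> copair)"
    unfolding b_b_middle_braid by simp
  also have "(\<sigma> A A \<otimes> \<iota> A \<otimes> \<iota> A) \<cdot> (\<iota> A \<otimes> \<iota> A \<otimes> copair) = (\<iota> A \<otimes> \<iota> A \<otimes> copair) \<cdot> \<sigma> A A"
    using tensor_comp[of "\<iota> A \<otimes> \<iota> A" "\<sigma> A A" copair "\<iota> A \<otimes> \<iota> A"] state_tensor_right[of copair "\<sigma> A A"]
    by simp
  also have "b \<cdot> (\<iota> A \<otimes> b \<otimes> \<iota> A) \<cdot> (\<iota> A \<otimes> \<iota> A \<otimes> copair) \<cdot> \<sigma> A A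
      = b \<cdot> (\<iota> A \<otimes> ((b \<otimes> \<iota> A) \<cdot> (\<iota> A \<otimes> copair))) \<cdot> \<sigma> A A"
    by (simp add: whisker_left)
  also have "\<dots> = b \<cdot> \<sigma> A A"
    unfolding zigzag_left by simp
  finally show ?thesis .
qed

text \<open>Pairing off the first leg turns either state into \<open>N\<close>, the left one by
  definition of \<open>N\<close>. Bending back with \<open>copair\<close> undoes this, so the states
  agree.\<close>

lemma copair_N: "\<sigma> A A \<cdot> copair = (\<iota> A \<otimes> N) \<cdot> copair"
proof -
  have *: "(\<iota> A \<otimes> b \<otimes> \<iota> A) \<cdot> (\<iota> A \<otimes> \<iota> A \<otimes> f) \<cdot> copair = f"
    if [simp]: "f \<in> Mor C" "Dom C f = \<one>" "Cod C f = A \<odot> A" for f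
  proof -
    have "(\<iota> A \<otimes> \<iota> A \<otimes> f) \<cdot> copair = (copair \<otimes> \<iota> A \<otimes> \<iota> A) \<cdot> f"
      using state_tensor_left[of copair f] state_tensor_right[of f copair] by simp
    then have "(\<iota> A \<otimes> b \<otimes> \<iota> A) \<cdot> (\<iota> A \<otimes> \<iota> A \<otimes> f) \<cdot> copair
      = (((\<iota> A \<otimes> b) \<cdot> (copair \<otimes> \<iota> A)) \<otimes> \<iota> A) \<cdot> f"
      by (simp add: whisker_right)
    then show ?thesis unfolding zigzag_right by simp
  qed
  have 1: "(b \<otimes> \<iota> A) \<cdot> (\<iota> A \<otimes> (\<sigma> A A \<cdot> copair)) = N"
    by (simp add: N_eq whisker_left)
  have "(b \<otimes> \<iota> A) \<cdot> (\<iota> A \<otimes> \<iota> A \<otimes> N) \<cdot> (\<iota> A \<otimes> copair) = N \<cdot> (b \<otimes> \<iota> A) \<cdot> (\<iota> A \<otimes> copair)"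
    using effect_tensor_left[of b N] tensor_comp[of "\<iota> A \<otimes> \<iota> A" b N "\<iota> A"]
    by (subst (1 2) Comp_assoc'[symmetric]) simp_all
  then have 2: "(b \<otimes> \<iota> A) \<cdot> (\<iota> A \<otimes> ((\<iota> A \<otimes> N) \<cdot> copair)) = N"
    unfolding zigzag_left by (simp add: whisker_left)
  have "\<sigma> A A \<cdot> copair = (\<iota> A \<otimes> ((b \<otimes> \<iota> A) \<cdot> (\<iota> A \<otimes> (\<sigma> A A \<cdot> copair)))) \<cdot> copair"
    using *[of "\<sigma> A A \<cdot> copair"] by (simp add: whisker_left)
  also have "\<dots> = (\<iota> A \<otimes> ((b \<otimes> \<iota> A) \<cdot> (\<iota> A \<otimes> ((\<iota> A \<otimes> N) \<cdot> copair)))) \<cdot> copair"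
    unfolding 1 2 ..
  also have "\<dots> = (\<iota> A \<otimes> N) \<cdot> copair"
    using *[of "(\<iota> A \<otimes> N) \<cdot> copair"] by (simp add: whisker_left)
  finally show ?thesis .
qed

section \<open>Compatibility of \<open>N\<close> with unit, counit and product\<close>

lemma b_unit: "b \<cdot> (\<eta> \<otimes> \<iota> A) = \<epsilon>" "b \<cdot> (\<iota> A \<otimes> \<eta>) = \<epsilon>"
  by (simp_all add: b_def mult_unit_left mult_unit_right)

lemma b_mult: "b \<cdot> (\<mu> \<otimes> \<iota> A) = b \<cdot> (\<iota> A \<otimes> \<mu>)"
  by (simp add: b_def mult_assoc)

lemma N_unit: "N \<cdot> \<eta> = \<eta>"
proof (rule b_nondegenerate)
  have "b \<cdot> (\<iota> A \<otimes> (N \<cdot> \<eta>)) = (b \<cdot> (\<iota> A \<otimes> N)) \<cdot> (\<iota> A \<otimes> \<eta>)"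
    by (simp add: whisker_left)
  also have "\<dots> = b \<cdot> (\<eta> \<otimes> \<iota> A)"
    unfolding b_N using Braid_nat[of "\<iota> A" \<eta> A A] by simp
  finally show "b \<cdot> (\<iota> A \<otimes> (N \<cdot> \<eta>)) = b \<cdot> (\<iota> A \<otimes> \<eta>)" by (simp add: b_unit)
qed simp_all

lemma N_counit: "\<epsilon> \<cdot> N = \<epsilon>"
proof -
  have "\<epsilon> \<cdot> N = (b \<cdot> (\<eta> \<otimes> \<iota> A)) \<cdot> N" by (simp add: b_unit)
  also have "\<dots> = (b \<cdot> (\<iota> A \<otimes> N)) \<cdot> (\<eta> \<otimes> \<iota> A)"
    using state_tensor_left[of \<eta> N] by (simp add: tensor_comp)
  also have "\<dots> = b \<cdot> (\<iota> A \<otimes> \<eta>)"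
    unfolding b_N using Braid_nat[of \<eta> "\<iota> A" A A] by simp
  finally show ?thesis by (simp add: b_unit)
qed

text \<open>Moving the last of three wires to the front twice moves the first to the end. The
  numerals serve only as labels for the coherence lemmas.\<close>

lemma Braid_rotate_twice: "\<sigma> (A \<odot> A) A \<cdot> \<sigma> (A \<odot> A) A = \<sigma> A (A \<odot> A)"
  using perm_swap[of "[0::nat, 1]" "[2]"] perm_swap[of "[1::nat, 2]" "[0]"]
    perm_swap[of "[0::nat]" "[1, 2]"] perm_comp[of "[0::nat, 1, 2]" "[2, 0, 1]" "[1, 2, 0]"]
    perm_swap[of "[2::nat, 0]" "[1]"]
  by simp

text \<open>Tested against \<open>x\<close> and written with elements, \<open>b_N\<close> and
  \<open>b_mult\<close> alternate: \<open>b(x, N(yz)) = b(yz, x) = b(y, zx) = b(zx, Ny) = b(z, x Ny)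
  = b(x Ny, Nz) = b(x, Ny Nz)\<close>.\<close>

lemma N_mult: "N \<cdot> \<mu> = \<mu> \<cdot> (N \<otimes> N)"
proof (rule b_nondegenerate)
  have "b \<cdot> (\<iota> A \<otimes> (N \<cdot> \<mu>)) = (b \<cdot> (\<iota> A \<otimes> N)) \<cdot> (\<iota> A \<otimes> \<mu>)"
    by (simp add: whisker_left)
  also have "\<dots> = (b \<cdot> (\<mu> \<otimes> \<iota> A)) \<cdot> \<sigma> A (A \<odot> A)"
    unfolding b_N using Braid_nat[of "\<iota> A" \<mu> A A] by simp
  also have "\<dots> = (b \<cdot> (\<mu> \<otimes> \<iota> A)) \<cdot> \<sigma> (A \<odot> A) A \<cdot> \<sigma> (A \<odot> A) A"
    unfolding Braid_rotate_twice ..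
  also have "\<dots> = b \<cdot> (\<iota> A \<otimes> \<mu>) \<cdot> \<sigma> (A \<odot> A) A \<cdot> \<sigma> (A \<odot> A) A"
    unfolding b_mult by simp
  also have "\<dots> = (b \<cdot> \<sigma> A A) \<cdot> (\<mu> \<otimes> \<iota> A) \<cdot> \<sigma> (A \<odot> A) A"
    by (simp add: Braid_nat')
  also have "\<dots> = (b \<cdot> (\<mu> \<otimes> \<iota> A)) \<cdot> (\<iota> A \<otimes> \<iota> A \<otimes> N) \<cdot> \<sigma> (A \<odot> A) A"
    unfolding b_N[symmetric] using tensor_comp'[of "\<iota> A \<otimes> \<iota> A" \<mu> N "\<iota> A" "\<sigma> (A \<odot> A) A"]
      tensor_comp'[of \<mu> "\<iota> A" "\<iota> A" N "\<sigma> (A \<odot> A) A"] by simp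
  also have "\<dots> = b \<cdot> (\<iota> A \<otimes> \<mu>) \<cdot> (\<iota> A \<otimes> \<iota> A \<otimes> N) \<cdot> \<sigma> (A \<odot> A) A"
    unfolding b_mult by simp
  also have "\<dots> = (b \<cdot> \<sigma> A A) \<cdot> ((\<mu> \<cdot> (\<iota> A \<otimes> N)) \<otimes> \<iota> A)"
    using Braid_nat[of "\<mu> \<cdot> (\<iota> A \<otimes> N)" "\<iota> A" A A] by (simp add: tensor_comp')
  also have "\<dots> = (b \<cdot> (\<mu> \<otimes> \<iota> A)) \<cdot> (\<iota> A \<otimes> N \<otimes> N)"
    unfolding b_N[symmetric] using tensor_comp[of "\<mu> \<cdot> (\<iota> A \<otimes> N)" "\<iota> A" "\<iota> A" N]
      tensor_comp[of "\<iota> A \<otimes> N" \<mu> N "\<iota> A"] by simp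
  also have "\<dots> = b \<cdot> (\<iota> A \<otimes> (\<mu> \<cdot> (N \<otimes> N)))"
    unfolding b_mult by (simp add: whisker_left)
  finally show "b \<cdot> (\<iota> A \<otimes> (N \<cdot> \<mu>)) = b \<cdot> (\<iota> A \<otimes> (\<mu> \<cdot> (N \<otimes> N)))" .
qed simp_all

end

section \<open>Words\<close>

locale involutive_frobenius_algebra = symmetric_frobenius_algebra C A \<mu> \<eta> \<Delta> \<epsilon>
  for C :: "('o, 'm, 'z) monoidal_data_scheme" (structure) and A \<mu> \<eta> \<Delta> \<epsilon> +
  assumes separable: "\<mu> \<cdot> \<Delta> \<cdot> \<eta> = \<eta>"
    and N_N [simp]: "N \<cdot> N = \<iota> A"
begin

text \<open>The counterpart of \<open>copair_N\<close> for the first leg, obtained by crossing the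
  legs once more.\<close>

lemma copair_symm_N: "copair = (N \<otimes> \<iota> A) \<cdot> \<sigma> A A \<cdot> copair"
proof -
  have "copair = \<sigma> A A \<cdot> \<sigma> A A \<cdot> copair" by simp
  also have "\<dots> = \<sigma> A A \<cdot> (\<iota> A \<otimes> N) \<cdot> copair" unfolding copair_N ..
  also have "\<dots> = (N \<otimes> \<iota> A) \<cdot> \<sigma> A A \<cdot> copair" by (simp add: Braid_nat')
  finally show ?thesis .
qed

text \<open>As \<open>N\<close> squares to the identity, exponents matter only modulo 2: Booleans,
  added by \<open>\<noteq>\<close>.\<close>

definition Npow :: "bool \<Rightarrow> 'm" where "Npow p = (if p then N else \<iota> A)"

lemma Npow_simps [simp]: "Npow p \<in> Mor C" "Dom C (Npow p) = A" "Cod C (Npow p) = A"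
  "Npow False = \<iota> A" "Npow p \<cdot> Npow q = Npow (p \<noteq> q)"
  by (auto simp: Npow_def)

text \<open>Signs are encoded as Booleans: \<open>True\<close> stands for \<open>+1\<close>, so \<open>cc True\<close> is \<open>c\<^sub>1\<close> and multiplication of
  signs is equality of Booleans.\<close>

definition cc :: "bool \<Rightarrow> 'm" where "cc s = (if s then \<sigma> A A \<cdot> copair else copair)"

lemma cc_simps [simp]: "cc s \<in> Mor C" "Dom C (cc s) = \<one>" "Cod C (cc s) = A \<odot> A"
  by (auto simp: cc_def)

text \<open>Each \<open>N\<close> on a leg reverses the sign: \<open>copair_N\<close> covers the
  second leg, \<open>copair_symm_N\<close> the first, and \<open>N_N\<close> the way back.\<close>

lemma Npow_cc: "(Npow p \<otimes> Npow q) \<cdot> cc s = cc (s \<noteq> (p \<noteq> q))"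
proof -
  have r: "(\<iota> A \<otimes> N) \<cdot> cc s = cc (\<not> s)" for s
    using tensor_comp'[of "\<iota> A" "\<iota> A" N N copair] by (simp add: cc_def copair_N)
  have l: "(N \<otimes> \<iota> A) \<cdot> cc s = cc (\<not> s)" for s
    using tensor_comp'[of N N "\<iota> A" "\<iota> A" "\<sigma> A A \<cdot> copair"] copair_symm_N by (simp add: cc_def)
  have "(Npow p \<otimes> Npow q) \<cdot> cc s = (Npow p \<otimes> \<iota> A) \<cdot> (\<iota> A \<otimes> Npow q) \<cdot> cc s"
    by (simp add: tensor_comp')
  then show ?thesis by (cases p; cases q) (simp_all add: Npow_def l r)
qed

text \<open>Exponents belong to labels rather than positions, so they travel with their wires under
  permutations; \<open>perm_flips\<close> is this naturality.\<close>

definition flips :: "('l \<Rightarrow> bool) \<Rightarrow> 'l list \<Rightarrow> 'm" where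
  "flips k xs = tensor_list C (map (\<lambda>l. Npow (k l)) xs)"

lemma flips_Nil [simp]: "flips k [] = \<iota> \<one>"
  and flips_Cons [simp]: "flips k (x # xs) = Npow (k x) \<otimes> flips k xs"
  by (simp_all add: flips_def)

lemma flips_simps [simp]:
  "flips k xs \<in> Mor C" "Dom C (flips k xs) = pow xs" "Cod C (flips k xs) = pow xs"
  by (induction xs) simp_all

lemma flips_append [simp]: "flips k (xs @ ys) = flips k xs \<otimes> flips k ys"
  by (induction xs) simp_all

lemma flips_id: "(\<And>l. l \<in> set xs \<Longrightarrow> \<not> k l) \<Longrightarrow> flips k xs = \<iota> (pow xs)"
  by (induction xs) simp_all

lemma flips_comp: "flips k xs \<cdot> flips j xs = flips (\<lambda>l. k l \<noteq> j l) xs"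
  by (induction xs) (simp_all add: tensor_comp)

lemma perm_flips:
  assumes "mset xs = mset ys"
  shows "perm xs ys \<cdot> flips k xs = flips k ys \<cdot> perm xs ys"
  using assms
proof (induction ys arbitrary: xs)
  case Nil
  then show ?case by simp
next
  case (Cons y ys)
  obtain P Q where xs: "xs = P @ y # Q" "y \<notin> set P" "mset (P @ Q) = mset ys"
    using Cons.prems by (rule mset_Cons_splitE)
  have len: "pow (P @ Q) = pow ys" using xs by (metis mset_eq_length)
  let ?b = "\<sigma> (pow P) A \<otimes> \<iota> (pow Q)"
  have "perm xs (y # ys) \<cdot> flips k xs
    = (\<iota> A \<otimes> perm (P @ Q) ys) \<cdot> ?b \<cdot> ((flips k P \<otimes> Npow (k y)) \<otimes> flips k Q)"
    using perm_Cons[OF xs(2), of Q ys] xs len by simp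
  also have "?b \<cdot> ((flips k P \<otimes> Npow (k y)) \<otimes> flips k Q)
    = (Npow (k y) \<otimes> flips k (P @ Q)) \<cdot> ?b"
    using Braid_nat[of "flips k P" "Npow (k y)" "pow P" A]
      tensor_comp[of "\<sigma> (pow P) A" "Npow (k y) \<otimes> flips k P" "\<iota> (pow Q)" "flips k Q"]
    by (subst tensor_comp) simp_all
  also have "(\<iota> A \<otimes> perm (P @ Q) ys) \<cdot> (Npow (k y) \<otimes> flips k (P @ Q)) \<cdot> ?b
    = (Npow (k y) \<otimes> (perm (P @ Q) ys \<cdot> flips k (P @ Q))) \<cdot> ?b"
    using xs by (simp add: tensor_comp')
  also have "\<dots> = (Npow (k y) \<otimes> flips k ys) \<cdot> (\<iota> A \<otimes> perm (P @ Q) ys) \<cdot> ?b"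
    using Cons.IH[OF xs(3)] xs len by (simp add: tensor_comp')
  finally show ?case using perm_Cons[OF xs(2), of Q ys] xs by simp
qed

text \<open>Ending in \<open>\<eta>\<close> admits the empty word, so concatenation and contraction
  need no case distinction.\<close>

primrec mul :: "nat \<Rightarrow> 'm" where
  "mul 0 = \<eta>"
| "mul (Suc n) = \<mu> \<cdot> (\<iota> A \<otimes> mul n)"

lemma mul_simps [simp]:
  "mul n \<in> Mor C" "Dom C (mul n) = tensor_power C A n" "Cod C (mul n) = A"
  by (induction n) simp_all

lemma mul_add: "mul (m + n) = \<mu> \<cdot> (mul m \<otimes> mul n)"
proof (induction m)
  case 0
  have "\<mu> \<cdot> (\<eta> \<otimes> mul n) = (\<mu> \<cdot> (\<eta> \<otimes> \<iota> A)) \<cdot> mul n"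
    using state_tensor_left[of \<eta> "mul n"] by simp
  then show ?case by (simp add: mult_unit_left)
next
  case (Suc m)
  have "\<mu> \<cdot> (\<iota> A \<otimes> (\<mu> \<cdot> (mul m \<otimes> mul n))) = (\<mu> \<cdot> (\<iota> A \<otimes> \<mu>)) \<cdot> (\<iota> A \<otimes> mul m \<otimes> mul n)"
    by (simp add: whisker_left)
  also have "\<dots> = \<mu> \<cdot> (\<mu> \<otimes> \<iota> A) \<cdot> ((\<iota> A \<otimes> mul m) \<otimes> mul n)"
    unfolding mult_assoc[symmetric] by simp
  also have "\<dots> = \<mu> \<cdot> (mul (Suc m) \<otimes> mul n)"
    by (subst tensor_comp) simp_all
  finally show ?case using Suc by simp
qed

lemma mul_flips: "mul (length xs) \<cdot> flips (\<lambda>_. True) xs = N \<cdot> mul (length xs)"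
proof (induction xs)
  case (Cons x xs)
  have "mul (length (x # xs)) \<cdot> flips (\<lambda>_. True) (x # xs) = \<mu> \<cdot> (N \<otimes> (N \<cdot> mul (length xs)))"
    using tensor_comp'[of N "\<iota> A" "flips (\<lambda>_. True) xs" "mul (length xs)"]
    by (simp add: tensor_comp Cons[symmetric] Npow_def)
  also have "\<dots> = (N \<cdot> \<mu>) \<cdot> (\<iota> A \<otimes> mul (length xs))"
    unfolding N_mult by (simp add: tensor_comp)
  finally show ?case by simp
qed (simp add: N_unit)

section \<open>Cyclic words\<close>

definition tr :: "nat \<Rightarrow> 'm" where "tr n = \<epsilon> \<cdot> mul n"

lemma tr_simps [simp]:
  "tr n \<in> Mor C" "Dom C (tr n) = tensor_power C A n" "Cod C (tr n) = \<one>"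
  by (simp_all add: tr_def)

lemma tr_Suc: "tr (Suc n) = b \<cdot> (\<iota> A \<otimes> mul n)"
  by (simp add: tr_def b_def)

lemma tr_add: "tr (m + n) = b \<cdot> (mul m \<otimes> mul n)"
  by (simp add: tr_def b_def mul_add)

text \<open>\<open>N\<close> respects unit and product, so it can be pulled out of the whole word,
  where the counit absorbs it.\<close>

lemma tr_flips: "tr (length xs) \<cdot> flips (\<lambda>_. True) xs = tr (length xs)"
proof -
  have "tr (length xs) \<cdot> flips (\<lambda>_. True) xs = (\<epsilon> \<cdot> N) \<cdot> mul (length xs)"
    by (simp add: tr_def mul_flips)
  then show ?thesis unfolding N_counit by (simp add: tr_def)
qed

text \<open>The pairing is invariant under \<open>N\<close> in both arguments; since
  \<open>N\<close> is its own inverse, a single \<open>N\<close> may change arguments.\<close>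

lemma b_N_left: "b \<cdot> (N \<otimes> \<iota> A) = b \<cdot> \<sigma> A A"
proof -
  have "b \<cdot> (N \<otimes> N) = (\<epsilon> \<cdot> N) \<cdot> \<mu>" by (simp add: b_def N_mult)
  then have "b \<cdot> (N \<otimes> N) = b" unfolding N_counit by (simp add: b_def)
  then have "b \<cdot> (N \<otimes> \<iota> A) = (b \<cdot> (N \<otimes> N)) \<cdot> (N \<otimes> \<iota> A)" by simp
  also have "\<dots> = b \<cdot> (\<iota> A \<otimes> N)" by (simp add: tensor_comp)
  finally show ?thesis by (simp add: b_N)
qed

text \<open>The twisted trace property \<open>b(x, w) = b(w, N x)\<close> with \<open>w\<close> the
  product of the remaining letters.\<close>

lemma tr_cyclic:
  assumes "distinct (x # xs)"
  shows "tr (length (x # xs)) = tr (length (xs @ [x])) \<cdot> perm (x # xs) (xs @ [x]) \<cdot> flips (\<lambda>l. l = x) (x # xs)"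
proof -
  have "tr (length (xs @ [x])) = b \<cdot> (mul (length xs) \<otimes> \<iota> A)"
    using tr_add[of "length xs" 1] by (simp add: length_append mult_unit_right)
  moreover have "perm (x # xs) (xs @ [x]) = \<sigma> A (pow xs)"
    using perm_swap[of "[x]" xs] assms by simp
  moreover have "flips (\<lambda>l. l = x) (x # xs) = N \<otimes> \<iota> (pow xs)"
    using assms by (subst flips_Cons, subst flips_id) (auto simp: Npow_def)
  moreover have "b \<cdot> (mul (length xs) \<otimes> \<iota> A) \<cdot> \<sigma> A (pow xs) \<cdot> (N \<otimes> \<iota> (pow xs))
    = (b \<cdot> \<sigma> A A) \<cdot> (\<iota> A \<otimes> mul (length xs)) \<cdot> (N \<otimes> \<iota> (pow xs))"
    by (simp add: Braid_nat')
  moreover have "\<dots> = b \<cdot> (\<iota> A \<otimes> mul (length xs))"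
    unfolding b_N_left[symmetric] by (simp add: tensor_comp tensor_comp')
  ultimately show ?thesis by (simp add: tr_Suc)
qed

text \<open>Nesting the two pairings introduces a crossing on the contracted legs. It cancels the
  crossing in \<open>cc True\<close>, which is why this sign is the right one, and the remaining
  copairing meets the inner pairing in a snake.\<close>

lemma tr_join:
  "(tr (Suc m) \<otimes> tr (Suc n)) \<cdot> (\<iota> A \<otimes> \<sigma> A (tensor_power C A m) \<otimes> \<iota> (tensor_power C A n)) \<cdot>
    (cc True \<otimes> \<iota> (tensor_power C A m) \<otimes> \<iota> (tensor_power C A n)) = tr (m + n)"
proof -
  let ?p = "tensor_power C A m" and ?q = "tensor_power C A n"
  have "(tr (Suc m) \<otimes> tr (Suc n)) \<cdot> (\<iota> A \<otimes> \<sigma> A ?p \<otimes> \<iota> ?q)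
    = (b \<otimes> b) \<cdot> (\<iota> A \<otimes> (mul m \<otimes> \<iota> A) \<otimes> mul n) \<cdot> (\<iota> A \<otimes> \<sigma> A ?p \<otimes> \<iota> ?q)"
    using tensor_comp[of "\<iota> A \<otimes> mul m" b "\<iota> A \<otimes> mul n" b]
    by (simp add: tr_Suc flip: Comp_assoc')
  also have "(\<iota> A \<otimes> (mul m \<otimes> \<iota> A) \<otimes> mul n) \<cdot> (\<iota> A \<otimes> \<sigma> A ?p \<otimes> \<iota> ?q)
    = \<iota> A \<otimes> ((mul m \<otimes> \<iota> A) \<cdot> \<sigma> A ?p) \<otimes> mul n"
    by (simp add: tensor_comp del: TensorMor_assoc)
  also have "(mul m \<otimes> \<iota> A) \<cdot> \<sigma> A ?p = \<sigma> A A \<cdot> (\<iota> A \<otimes> mul m)"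
    by (simp add: Braid_nat)
  also have "\<iota> A \<otimes> (\<sigma> A A \<cdot> (\<iota> A \<otimes> mul m)) \<otimes> mul n
    = (\<iota> A \<otimes> \<sigma> A A \<otimes> \<iota> A) \<cdot> (\<iota> A \<otimes> (\<iota> A \<otimes> mul m) \<otimes> mul n)"
    by (simp add: tensor_comp del: TensorMor_assoc)
  also have "(b \<otimes> b) \<cdot> (\<iota> A \<otimes> \<sigma> A A \<otimes> \<iota> A) \<cdot> (\<iota> A \<otimes> (\<iota> A \<otimes> mul m) \<otimes> mul n)
    = ((b \<otimes> b) \<cdot> (\<iota> A \<otimes> \<sigma> A A \<otimes> \<iota> A)) \<cdot> (\<iota> A \<otimes> \<iota> A \<otimes> mul m \<otimes> mul n)"
    by simp
  finally have "(tr (Suc m) \<otimes> tr (Suc n)) \<cdot> (\<iota> A \<otimes> \<sigma> A ?p \<otimes> \<iota> ?q)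
    = b \<cdot> (\<iota> A \<otimes> b \<otimes> \<iota> A) \<cdot> (\<sigma> A A \<otimes> \<iota> A \<otimes> \<iota> A) \<cdot> (\<iota> A \<otimes> \<iota> A \<otimes> mul m \<otimes> mul n)"
    unfolding b_b_middle_braid by simp
  then have "((tr (Suc m) \<otimes> tr (Suc n)) \<cdot> (\<iota> A \<otimes> \<sigma> A ?p \<otimes> \<iota> ?q)) \<cdot> (cc True \<otimes> \<iota> ?p \<otimes> \<iota> ?q)
    = b \<cdot> (\<iota> A \<otimes> b \<otimes> \<iota> A) \<cdot> (\<sigma> A A \<otimes> \<iota> A \<otimes> \<iota> A) \<cdot> (\<iota> A \<otimes> \<iota> A \<otimes> mul m \<otimes> mul n) \<cdot> (cc True \<otimes> \<iota> ?p \<otimes> \<iota> ?q)"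
    by simp
  also have "(\<iota> A \<otimes> \<iota> A \<otimes> mul m \<otimes> mul n) \<cdot> (cc True \<otimes> \<iota> ?p \<otimes> \<iota> ?q) = cc True \<otimes> mul m \<otimes> mul n"
    using tensor_comp[of "cc True" "\<iota> A \<otimes> \<iota> A" "\<iota> ?p \<otimes> \<iota> ?q" "mul m \<otimes> mul n"] by simp
  also have "(\<sigma> A A \<otimes> \<iota> A \<otimes> \<iota> A) \<cdot> (cc True \<otimes> mul m \<otimes> mul n) = copair \<otimes> mul m \<otimes> mul n"
    by (subst tensor_comp) (simp_all add: cc_def)
  also have "\<dots> = (copair \<otimes> \<iota> A \<otimes> \<iota> A) \<cdot> (mul m \<otimes> mul n)"
    using state_tensor_left[of copair "mul m \<otimes> mul n"] by simp
  also have "b \<cdot> (\<iota> A \<otimes> b \<otimes> \<iota> A) \<cdot> (copair \<otimes> \<iota> A \<otimes> \<iota> A) \<cdot> (mul m \<otimes> mul n)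
    = b \<cdot> (((\<iota> A \<otimes> b) \<cdot> (copair \<otimes> \<iota> A)) \<otimes> \<iota> A) \<cdot> (mul m \<otimes> mul n)"
    by (simp add: whisker_right)
  also have "\<dots> = tr (m + n)" unfolding zigzag_right by (simp add: tr_add)
  finally show ?thesis by simp
qed

text \<open>Associativity isolates the product of the two contracted letters, and separability makes
  it the unit.\<close>

lemma tr_bubble: "tr (Suc (Suc n)) \<cdot> (cc False \<otimes> \<iota> (tensor_power C A n)) = tr n"
proof -
  have "tr (Suc (Suc n)) \<cdot> (cc False \<otimes> \<iota> (tensor_power C A n))
    = \<epsilon> \<cdot> (\<mu> \<cdot> (\<iota> A \<otimes> \<mu>)) \<cdot> (\<iota> A \<otimes> \<iota> A \<otimes> mul n) \<cdot> (copair \<otimes> \<iota> (tensor_power C A n))"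
    by (simp add: tr_def whisker_left cc_def)
  also have "(\<iota> A \<otimes> \<iota> A \<otimes> mul n) \<cdot> (copair \<otimes> \<iota> (tensor_power C A n)) = (copair \<otimes> \<iota> A) \<cdot> mul n"
    using tensor_comp[of copair "\<iota> A \<otimes> \<iota> A" "\<iota> (tensor_power C A n)" "mul n"]
      state_tensor_left[of copair "mul n"] by simp
  also have "\<epsilon> \<cdot> (\<mu> \<cdot> (\<iota> A \<otimes> \<mu>)) \<cdot> (copair \<otimes> \<iota> A) \<cdot> mul n
    = \<epsilon> \<cdot> \<mu> \<cdot> ((\<mu> \<cdot> copair) \<otimes> \<iota> A) \<cdot> mul n"
    unfolding mult_assoc[symmetric] by (simp add: whisker_right)
  also have "\<mu> \<cdot> copair = \<eta>" by (simp add: copair_def separable)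
  also have "\<epsilon> \<cdot> \<mu> \<cdot> (\<eta> \<otimes> \<iota> A) \<cdot> mul n = \<epsilon> \<cdot> (\<mu> \<cdot> (\<eta> \<otimes> \<iota> A)) \<cdot> mul n" by simp
  also have "\<dots> = tr n" unfolding mult_unit_left by (simp add: tr_def)
  finally show ?thesis .
qed

section \<open>Contraction of words\<close>

lemma flips_cong: "(\<And>l. l \<in> set xs \<Longrightarrow> k l = j l) \<Longrightarrow> flips k xs = flips j xs"
  by (induction xs) simp_all

text \<open>Exponents on contracted letters are absorbed into the sign of the contraction, so only
  exponents on the other letters survive.\<close>

lemma flips_state:
  "flips k (x # y # zs) \<cdot> (cc s \<otimes> \<iota> (pow zs)) = (cc (s \<noteq> (k x \<noteq> k y)) \<otimes> \<iota> (pow zs)) \<cdot> flips k zs"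
proof -
  have "flips k (x # y # zs) \<cdot> (cc s \<otimes> \<iota> (pow zs))
    = ((Npow (k x) \<otimes> Npow (k y)) \<otimes> flips k zs) \<cdot> (cc s \<otimes> \<iota> (pow zs))"
    by simp
  also have "\<dots> = cc (s \<noteq> (k x \<noteq> k y)) \<otimes> flips k zs"
    by (simp add: tensor_comp Npow_cc del: TensorMor_assoc)
  finally show ?thesis
    using state_tensor_left[of "cc (s \<noteq> (k x \<noteq> k y))" "flips k zs"] by simp
qed

section \<open>Products of words with labelled inputs\<close>

definition traces :: "'l list list \<Rightarrow> 'm" where
  "traces xss = tensor_list C (map (\<lambda>xs. tr (length xs)) xss)"

lemma traces_Nil [simp]: "traces [] = \<iota> \<one>"
  and traces_Cons [simp]: "traces (xs # xss) = tr (length xs) \<otimes> traces xss"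
  by (simp_all add: traces_def)

lemma traces_simps [simp]:
  "traces xss \<in> Mor C" "Dom C (traces xss) = pow (concat xss)" "Cod C (traces xss) = \<one>"
  by (induction xss) simp_all

lemma traces_append [simp]: "traces (xss @ yss) = traces xss \<otimes> traces yss"
  by (induction xss) simp_all

text \<open>\<open>val k xss zs\<close> is the product of the words \<open>xss\<close> in which \<open>N\<close> is applied to every letter \<open>l\<close>
  with \<open>k l\<close>, as a morphism from a tensor power of \<open>A\<close> to the unit with inputs in the order \<open>zs\<close>.\<close>

definition val :: "('l \<Rightarrow> bool) \<Rightarrow> 'l list list \<Rightarrow> 'l list \<Rightarrow> 'm" where
  "val k xss zs = traces xss \<cdot> perm zs (concat xss) \<cdot> flips k zs"

lemma val_simps [simp]:
  assumes "mset zs = mset (concat xss)"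
  shows "val k xss zs \<in> Mor C" "Dom C (val k xss zs) = pow zs" "Cod C (val k xss zs) = \<one>"
  using assms by (simp_all add: val_def)

lemma val_cong: "(\<And>l. l \<in> set zs \<Longrightarrow> k l = j l) \<Longrightarrow> val k xss zs = val j xss zs"
  unfolding val_def using flips_cong[of zs k j] by simp

text \<open>Lifts an identity for one word to the first word of a product. The guard
  \<open>l \<in> set xs\<close> keeps \<open>j\<close> from acting on letters of the other
  words.\<close>

lemma val_head:
  assumes tr: "tr (length xs) = tr (length ys) \<cdot> perm xs ys \<cdot> flips j xs"
    and ms: "mset xs = mset ys" and zs: "mset zs = mset (concat (xs # xss))" "distinct zs"
  shows "val k (xs # xss) zs = val (\<lambda>l. k l \<noteq> (l \<in> set xs \<and> j l)) (ys # xss) zs"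
proof -
  let ?c = "concat xss" and ?j = "\<lambda>l. l \<in> set xs \<and> j l"
  have d: "distinct (xs @ ?c)" using mset_eq_imp_distinct_iff[of zs "xs @ ?c"] zs by simp
  have len: "pow ys = pow xs" using mset_eq_length[OF ms] by simp
  have j: "flips ?j (xs @ ?c) = flips j xs \<otimes> \<iota> (pow ?c)"
  proof -
    have "flips ?j ?c = \<iota> (pow ?c)" by (rule flips_id) (use d in auto)
    moreover have "flips ?j xs = flips j xs" by (rule flips_cong) simp
    ultimately show ?thesis by simp
  qed
  have "traces (xs # xss) = (tr (length ys) \<otimes> traces xss) \<cdot> (perm xs ys \<otimes> \<iota> (pow ?c)) \<cdot> (flips j xs \<otimes> \<iota> (pow ?c))"
    using tr ms len by (simp add: tensor_comp)
  also have "\<dots> = traces (ys # xss) \<cdot> perm (xs @ ?c) (ys @ ?c) \<cdot> flips ?j (xs @ ?c)"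
    using j ms by (subst perm_append) simp_all
  finally have "val k (xs # xss) zs
    = traces (ys # xss) \<cdot> perm (xs @ ?c) (ys @ ?c) \<cdot> (flips ?j (xs @ ?c) \<cdot> perm zs (xs @ ?c)) \<cdot> flips k zs"
    unfolding val_def using zs ms len by simp
  \<comment> \<open>Naturality carries the inserted factors \<open>N\<close> back to the input order
    \<open>zs\<close>, where they merge with those of \<open>k\<close>.\<close>
  also have "\<dots> = traces (ys # xss) \<cdot> perm (xs @ ?c) (ys @ ?c) \<cdot> (perm zs (xs @ ?c) \<cdot> flips ?j zs) \<cdot> flips k zs"
    using perm_flips[of zs "xs @ ?c" ?j] zs by simp
  also have "\<dots> = traces (ys # xss) \<cdot> perm zs (ys @ ?c) \<cdot> (flips k zs \<cdot> flips ?j zs)"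
    using zs ms len perm_comp'[of zs "xs @ ?c" "ys @ ?c"]
    by (simp add: flips_comp) (metis (no_types, lifting) flips_cong)
  finally show ?thesis by (simp add: val_def flips_comp)
qed

lemma val_cyclic:
  assumes "mset zs = mset (concat ((x # xs) # xss))" "distinct zs"
  shows "val k ((x # xs) # xss) zs = val (\<lambda>l. k l \<noteq> (l = x)) ((xs @ [x]) # xss) zs"
proof -
  have "distinct (x # xs)"
    using mset_eq_imp_distinct_iff[OF assms(1)] assms(2) by simp
  have "val k ((x # xs) # xss) zs
    = val (\<lambda>l. k l \<noteq> (l \<in> set (x # xs) \<and> l = x)) ((xs @ [x]) # xss) zs"
    by (rule val_head[OF tr_cyclic]) (use assms \<open>distinct (x # xs)\<close> in simp_all)
  also have "(\<lambda>l. k l \<noteq> (l \<in> set (x # xs) \<and> l = x)) = (\<lambda>l. k l \<noteq> (l = x))" by auto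
  finally show ?thesis .
qed

lemma val_cyclic':
  assumes "mset zs = mset (concat ((x # xs) # xss))" "distinct zs"
  shows "val k ((xs @ [x]) # xss) zs = val (\<lambda>l. k l \<noteq> (l = x)) ((x # xs) # xss) zs"
proof -
  have "(\<lambda>l. (k l \<noteq> (l = x)) \<noteq> (l = x)) = k" by auto
  then show ?thesis
    using val_cyclic[OF assms, of "\<lambda>l. k l \<noteq> (l = x)"] by (simp only:)
qed

lemma val_flip_word:
  assumes "mset zs = mset (concat (xs # xss))" "distinct zs"
  shows "val k (xs # xss) zs = val (\<lambda>l. k l \<noteq> (l \<in> set xs)) (xs # xss) zs"
  using val_head[of xs xs "\<lambda>_. True", OF _ refl assms] by (simp add: tr_flips)

text \<open>Words end in the unit object, where the braiding is trivial; naturality thus leaves only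
  a block swap of inputs, absorbed by coherence.\<close>

lemma val_swap:
  assumes "mset zs = mset (concat (xss @ yss))" "distinct zs"
  shows "val k (xss @ yss) zs = val k (yss @ xss) zs"
proof -
  let ?x = "concat xss" and ?y = "concat yss"
  have d: "distinct (?x @ ?y)" using mset_eq_imp_distinct_iff[OF assms(1)] assms(2) by simp
  have "traces (xss @ yss) = traces (yss @ xss) \<cdot> \<sigma> (pow ?x) (pow ?y)"
    using Braid_nat[of "traces xss" "traces yss" \<one> \<one>] by simp
  then have "val k (xss @ yss) zs
    = (traces (yss @ xss) \<cdot> perm (?x @ ?y) (?y @ ?x)) \<cdot> perm zs (?x @ ?y) \<cdot> flips k zs"
    using perm_swap[OF d] by (simp add: val_def)
  also have "\<dots> = val k (yss @ xss) zs"
    using assms perm_comp'[of zs "?x @ ?y" "?y @ ?x" "flips k zs"] by (simp add: val_def)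
  finally show ?thesis .
qed

text \<open>Common reduction for both contraction rules: exponents of \<open>x\<close> and
  \<open>y\<close> pass into the sign, and the other inputs are rearranged into an order
  \<open>vs\<close> suited to the words. What remains to evaluate, in the bracket, contains no
  exponents.\<close>

lemma val_contract:
  assumes zs: "mset zs = mset vs" "distinct (x # y # zs)"
    and xss: "mset (concat xss) = mset (x # y # vs)"
  shows "val k xss (x # y # zs) \<cdot> (cc s \<otimes> \<iota> (pow zs))
    = (traces xss \<cdot> perm (x # y # vs) (concat xss) \<cdot> (cc (s \<noteq> (k x \<noteq> k y)) \<otimes> \<iota> (pow vs))) \<cdot>
      perm zs vs \<cdot> flips k zs"
proof -
  let ?Z = "x # y # zs" and ?c = "cc (s \<noteq> (k x \<noteq> k y))"
  have ms: "mset ?Z = mset (x # y # vs)" "mset ?Z = mset (concat xss)" using zs xss by auto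
  have len: "pow (concat xss) = pow (x # y # vs)" "pow zs = pow vs"
    using mset_eq_length[OF xss] mset_eq_length[OF zs(1)] by simp_all
  have "val k xss ?Z \<cdot> (cc s \<otimes> \<iota> (pow zs))
    = traces xss \<cdot> perm ?Z (concat xss) \<cdot> (?c \<otimes> \<iota> (pow zs)) \<cdot> flips k zs"
    using ms flips_state[of k x y zs s] by (simp add: val_def)
  also have "\<dots> = traces xss \<cdot> perm (x # y # vs) (concat xss) \<cdot>
      perm ([x, y] @ zs) ([x, y] @ vs) \<cdot> (?c \<otimes> \<iota> (pow zs)) \<cdot> flips k zs"
    using ms xss zs perm_comp'[of ?Z "x # y # vs" "concat xss" "(?c \<otimes> \<iota> (pow zs)) \<cdot> flips k zs"]
    by (simp del: perm_Cons_same)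
  also have "perm ([x, y] @ zs) ([x, y] @ vs) \<cdot> (?c \<otimes> \<iota> (pow zs)) \<cdot> flips k zs
    = (((\<iota> A \<otimes> \<iota> A) \<otimes> perm zs vs) \<cdot> (?c \<otimes> \<iota> (pow zs))) \<cdot> flips k zs"
    using zs by simp
  also have "((\<iota> A \<otimes> \<iota> A) \<otimes> perm zs vs) \<cdot> (?c \<otimes> \<iota> (pow zs)) = (?c \<otimes> \<iota> (pow vs)) \<cdot> perm zs vs"
    using zs state_tensor_left[of ?c "perm zs vs"] by (subst tensor_comp) simp_all
  finally show ?thesis using xss zs len by simp
qed

text \<open>The condition on \<open>s\<close> says that the sign after absorbing both exponents is
  \<open>+1\<close>, as \<open>tr_join\<close> requires.\<close>

lemma val_join_aligned:
  assumes zs: "mset zs = mset (concat ((xs @ ys) # xss))" "distinct (x # y # zs)"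
    and s: "s = (k x = k y)"
  shows "val k ((x # xs) # (y # ys) # xss) (x # y # zs) \<cdot> (cc s \<otimes> \<iota> (pow zs))
    = val k ((xs @ ys) # xss) zs"
proof -
  let ?c = "concat xss"
  have d: "distinct (x # y # xs @ ys @ ?c)"
    using mset_eq_imp_distinct_iff[of "x # y # zs" "x # y # xs @ ys @ ?c"] zs by simp
  have "perm (x # y # xs @ ys @ ?c) (x # xs @ y # ys @ ?c)
    = \<iota> A \<otimes> perm (([y] @ xs) @ ys @ ?c) ((xs @ [y]) @ ys @ ?c)" by simp
  also have "\<dots> = \<iota> A \<otimes> \<sigma> A (pow xs) \<otimes> \<iota> (pow ys) \<otimes> \<iota> (pow ?c)"
    using d perm_swap[of "[y]" xs] by (subst perm_append) simp_all
  finally have "traces ((x # xs) # (y # ys) # xss) \<cdot> perm (x # y # xs @ ys @ ?c) (x # xs @ y # ys @ ?c) \<cdot>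
      (cc True \<otimes> \<iota> (pow (xs @ ys @ ?c)))
    = ((tr (Suc (length xs)) \<otimes> tr (Suc (length ys))) \<otimes> traces xss) \<cdot>
      ((\<iota> A \<otimes> \<sigma> A (pow xs) \<otimes> \<iota> (pow ys)) \<otimes> \<iota> (pow ?c)) \<cdot>
      ((cc True \<otimes> \<iota> (pow xs) \<otimes> \<iota> (pow ys)) \<otimes> \<iota> (pow ?c))"
    by simp
  also have "\<dots> = tr (length xs + length ys) \<otimes> traces xss"
    by (simp add: tr_join tensor_comp del: TensorMor_assoc)
  finally have "traces ((x # xs) # (y # ys) # xss) \<cdot> perm (x # y # xs @ ys @ ?c) (x # xs @ y # ys @ ?c) \<cdot>
      (cc True \<otimes> \<iota> (pow (xs @ ys @ ?c))) = traces ((xs @ ys) # xss)"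
    by (simp add: length_append)
  moreover have "(s \<noteq> (k x \<noteq> k y)) = True" using s by auto
  moreover have "val k ((x # xs) # (y # ys) # xss) (x # y # zs) \<cdot> (cc s \<otimes> \<iota> (pow zs))
    = (traces ((x # xs) # (y # ys) # xss) \<cdot>
        perm (x # y # xs @ ys @ ?c) (concat ((x # xs) # (y # ys) # xss)) \<cdot>
        (cc (s \<noteq> (k x \<noteq> k y)) \<otimes> \<iota> (pow (xs @ ys @ ?c)))) \<cdot> perm zs (xs @ ys @ ?c) \<cdot> flips k zs"
    by (rule val_contract) (use zs in simp_all)
  ultimately show ?thesis
    by (simp only: val_def concat.simps append_Cons append_assoc)
qed

text \<open>If the absorbed sign is wrong, applying \<open>N\<close> to the whole first word
  corrects it, and the surviving letters \<open>xs\<close> keep the extra \<open>N\<close>.\<close>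

lemma val_join:
  assumes zs: "mset zs = mset (concat ((xs @ ys) # xss))" "distinct (x # y # zs)"
  shows "val k ((x # xs) # (y # ys) # xss) (x # y # zs) \<cdot> (cc s \<otimes> \<iota> (pow zs))
    = val (\<lambda>l. k l \<noteq> (l \<in> set xs \<and> s \<noteq> (k x = k y))) ((xs @ ys) # xss) zs"
proof (cases "s = (k x = k y)")
  case True
  then show ?thesis using val_join_aligned[OF assms True] by simp
next
  case False
  let ?k = "\<lambda>l. k l \<noteq> (l \<in> set (x # xs))"
  have d: "distinct (x # y # xs)"
    using mset_eq_imp_distinct_iff[of "x # y # zs" "x # y # xs @ ys @ concat xss"] zs by simp
  have "val k ((x # xs) # (y # ys) # xss) (x # y # zs) = val ?k ((x # xs) # (y # ys) # xss) (x # y # zs)"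
    by (rule val_flip_word) (use assms in simp_all)
  moreover have "s = (?k x = ?k y)" using False d by auto
  ultimately have "val k ((x # xs) # (y # ys) # xss) (x # y # zs) \<cdot> (cc s \<otimes> \<iota> (pow zs))
      = val ?k ((xs @ ys) # xss) zs"
    using val_join_aligned[OF assms, of s ?k] by (simp only:)
  also have "\<dots> = val (\<lambda>l. k l \<noteq> (l \<in> set xs \<and> s \<noteq> (k x = k y))) ((xs @ ys) # xss) zs"
    by (rule val_cong) (use False assms in auto)
  finally show ?thesis .
qed

text \<open>Here the condition on \<open>s\<close> makes the absorbed sign \<open>-1\<close>, as
  \<open>tr_bubble\<close> requires.\<close>

lemma val_bubble:
  assumes zs: "mset zs = mset (concat (xs # xss))" "distinct (x # y # zs)"
    and s: "s = (k x \<noteq> k y)"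
  shows "val k ((x # y # xs) # xss) (x # y # zs) \<cdot> (cc s \<otimes> \<iota> (pow zs)) = val k (xs # xss) zs"
proof -
  let ?c = "concat xss"
  have "traces ((x # y # xs) # xss) \<cdot> perm (x # y # xs @ ?c) (x # y # xs @ ?c) \<cdot> (cc False \<otimes> \<iota> (pow (xs @ ?c)))
    = (tr (Suc (Suc (length xs))) \<otimes> traces xss) \<cdot> ((cc False \<otimes> \<iota> (pow xs)) \<otimes> \<iota> (pow ?c))"
    by simp
  also have "(tr (Suc (Suc (length xs))) \<otimes> traces xss) \<cdot> ((cc False \<otimes> \<iota> (pow xs)) \<otimes> \<iota> (pow ?c))
    = tr (length xs) \<otimes> traces xss"
    by (subst tensor_comp) (simp_all add: tr_bubble)
  also have "\<dots> = traces (xs # xss)" by simp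
  finally have "traces ((x # y # xs) # xss) \<cdot> perm (x # y # xs @ ?c) (x # y # xs @ ?c) \<cdot>
      (cc False \<otimes> \<iota> (pow (xs @ ?c))) = traces (xs # xss)" .
  moreover have "(s \<noteq> (k x \<noteq> k y)) = False" using s by auto
  moreover have "val k ((x # y # xs) # xss) (x # y # zs) \<cdot> (cc s \<otimes> \<iota> (pow zs))
    = (traces ((x # y # xs) # xss) \<cdot> perm (x # y # xs @ ?c) (concat ((x # y # xs) # xss)) \<cdot>
        (cc (s \<noteq> (k x \<noteq> k y)) \<otimes> \<iota> (pow (xs @ ?c)))) \<cdot> perm zs (xs @ ?c) \<cdot> flips k zs"
    by (rule val_contract) (use zs in simp_all)
  ultimately show ?thesis
    by (simp only: val_def concat.simps append_Cons append_assoc)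
qed

section \<open>Words with inner contractions\<close>

fun arc_labels :: "(bool \<times> 'l \<times> 'l) list \<Rightarrow> 'l list" where
  "arc_labels [] = []"
| "arc_labels ((s, x, y) # cs) = x # y # arc_labels cs"

fun arcs :: "(bool \<times> 'l \<times> 'l) list \<Rightarrow> 'm" where
  "arcs [] = \<iota> \<one>"
| "arcs ((s, x, y) # cs) = cc s \<otimes> arcs cs"

lemma arcs_simps [simp]: "arcs cs \<in> Mor C" "Dom C (arcs cs) = \<one>" "Cod C (arcs cs) = pow (arc_labels cs)"
  by (induction cs rule: arcs.induct) simp_all

definition net :: "('l \<Rightarrow> bool) \<Rightarrow> 'l list list \<Rightarrow> (bool \<times> 'l \<times> 'l) list \<Rightarrow> 'l list \<Rightarrow> 'm" where
  "net k xss cs as = val k xss (arc_labels cs @ as) \<cdot> (arcs cs \<otimes> \<iota> (pow as))"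

text \<open>Arcs are morphisms out of the unit, so the first can be plugged in after the others;
  contractions may thus be carried out one at a time.\<close>

lemma net_Cons:
  assumes "mset (x # y # arc_labels cs @ as) = mset (concat xss)"
  shows "net k xss ((s, x, y) # cs) as
    = (val k xss (x # y # arc_labels cs @ as) \<cdot> (cc s \<otimes> \<iota> (pow (arc_labels cs @ as)))) \<cdot> (arcs cs \<otimes> \<iota> (pow as))"
  using assms state_tensor_left[of "cc s" "arcs cs \<otimes> \<iota> (pow as)"] by (simp add: net_def)

lemma net_join:
  assumes "mset (arc_labels cs @ as) = mset (concat ((xs @ ys) # xss))"
    and "distinct (x # y # arc_labels cs @ as)"
  shows "net k ((x # xs) # (y # ys) # xss) ((s, x, y) # cs) as
    = net (\<lambda>l. k l \<noteq> (l \<in> set xs \<and> s \<noteq> (k x = k y))) ((xs @ ys) # xss) cs as"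
proof -
  have "mset (x # y # arc_labels cs @ as) = mset (concat ((x # xs) # (y # ys) # xss))"
    using assms(1) by simp
  from net_Cons[OF this] show ?thesis unfolding val_join[OF assms] net_def .
qed

lemma net_bubble:
  assumes "mset (arc_labels cs @ as) = mset (concat (xs # xss))"
    and "distinct (x # y # arc_labels cs @ as)"
    and "s = (k x \<noteq> k y)"
  shows "net k ((x # y # xs) # xss) ((s, x, y) # cs) as = net k (xs # xss) cs as"
proof -
  have "mset (x # y # arc_labels cs @ as) = mset (concat ((x # y # xs) # xss))"
    using assms(1) by simp
  from net_Cons[OF this, of k s] show ?thesis unfolding val_bubble[where k = k, OF assms] net_def .
qed

lemma net_cyclic:
  assumes "mset (arc_labels cs @ as) = mset (concat ((xs @ [x]) # xss))" "distinct (arc_labels cs @ as)"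
  shows "net k ((xs @ [x]) # xss) cs as = net (\<lambda>l. k l \<noteq> (l = x)) ((x # xs) # xss) cs as"
  using assms val_cyclic'[of "arc_labels cs @ as" x xs xss k] by (simp add: net_def)

lemma net_swap:
  assumes "mset (arc_labels cs @ as) = mset (concat (xss @ yss))" "distinct (arc_labels cs @ as)"
  shows "net k (xss @ yss) cs as = net k (yss @ xss) cs as"
  unfolding net_def val_swap[OF assms] ..

lemma net_flip_word:
  assumes "mset (arc_labels cs @ as) = mset (concat (xs # xss))" "distinct (arc_labels cs @ as)"
  shows "net k (xs # xss) cs as = net (\<lambda>l. k l \<noteq> (l \<in> set xs)) (xs # xss) cs as"
  unfolding net_def val_flip_word[OF assms, of k] ..

lemma net_cong:
  "(\<And>l. l \<in> set (arc_labels cs @ as) \<Longrightarrow> k l = j l) \<Longrightarrow> net k xss cs as = net j xss cs as"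
  unfolding net_def using val_cong[of "arc_labels cs @ as" k j xss] by simp

text \<open>An outer label \<open>a\<close> paired with the output \<open>a'\<close> has its sign \<open>k a\<close> moved into the words, so that all
  outer factors become \<open>c\<^sub>-\<^sub>1\<close>; \<open>cs\<close> lists the inner contractions.\<close>

lemma index_product_net:
  fixes ts :: "('l \<times> 'l \<times> 'l) list" and cs :: "(bool \<times> 'l \<times> 'l) list" and as as' :: "'l list"
  assumes len: "length as = length as'"
    and ms: "mset (arc_labels cs @ as) = mset (concat (map (\<lambda>(x, y, z). [x, y, z]) ts))"
    and dist: "distinct (arc_labels cs @ as @ as')"
    and k: "\<And>l. l \<in> set (arc_labels cs @ as') \<Longrightarrow> \<not> k l"
  shows "index_product C A (map (\<lambda>w. (tr 3, w)) ts)
      (map (\<lambda>(s, w). (cc s, w)) cs @ map (\<lambda>(a, a'). (cc (k a), a, a')) (zip as as')) as'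
    = (net k (map (\<lambda>(x, y, z). [x, y, z]) ts) cs as \<otimes> \<iota> (pow as')) \<cdot>
      perm (arc_labels (zip (replicate (length as) False) (zip as as'))) (as @ as') \<cdot>
      arcs (zip (replicate (length as) False) (zip as as'))"
proof -
  let ?I = "arc_labels (zip (replicate (length as) False) (zip as as'))"
  let ?S = "arcs (zip (replicate (length as) False) (zip as as'))"
  let ?ws = "map (\<lambda>(x, y, z). [x, y, z]) ts"
  let ?Sk = "tensor_list C (map fst (map (\<lambda>(a, a'). (cc (k a), a, a')) (zip as as')))"
  have I: "concat (map (\<lambda>(c, x, x'). [x, x']) (map (\<lambda>(a, a'). (cc (k a), a, a')) (zip as as'))) = ?I"
    using len by (induction as as' rule: list_induct2) simp_all
  have msI: "mset ?I = mset (as @ as')"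
    using len by (induction as as' rule: list_induct2) simp_all
  have Sk: "?Sk = flips k ?I \<cdot> ?S"
    using len k
  proof (induction as as' rule: list_induct2)
    case (Cons a as a' as')
    \<comment> \<open>\<open>k\<close> vanishes on the output \<open>a'\<close>, so the exponent of
      \<open>a\<close> alone determines the sign.\<close>
    have "(Npow (k a) \<otimes> Npow (k a')) \<cdot> cc False = cc (k a)"
      using Cons.prems[of a'] by (simp only: Npow_cc) simp
    moreover let ?J = "zip (replicate (length as) False) (zip as as')"
    have "((Npow (k a) \<otimes> Npow (k a')) \<otimes> flips k (arc_labels ?J)) \<cdot> (cc False \<otimes> arcs ?J)
      = ((Npow (k a) \<otimes> Npow (k a')) \<cdot> cc False) \<otimes> (flips k (arc_labels ?J) \<cdot> arcs ?J)"
      by (subst tensor_comp) simp_all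
    moreover have "tensor_list C (map fst (map (\<lambda>(a, a'). (cc (k a), a, a')) (zip as as')))
      = flips k (arc_labels ?J) \<cdot> arcs ?J"
      by (rule Cons.IH) (use Cons.prems in auto)
    ultimately show ?case by simp
  qed simp
  have cs: "tensor_list C (map fst (map (\<lambda>(s, w). (cc s, w)) cs @ F)) = arcs cs \<otimes> tensor_list C (map fst F)"
    if "tensor_list C (map fst F) \<in> Mor C" for F :: "('m \<times> 'l \<times> 'l) list"
    using that by (induction cs rule: arcs.induct) simp_all
  have csw: "concat (map (\<lambda>(c, x, x'). [x, x']) (map (\<lambda>(s, w). (cc s, w)) cs)) = arc_labels cs"
    by (induction cs rule: arcs.induct) simp_all
  have ts: "tensor_list C (map fst (map (\<lambda>w. (tr 3, w)) ts)) = traces ?ws"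
    by (induction ts) (auto simp: eval_nat_numeral)
  have tsw: "concat (map (\<lambda>(t, x, y, z). [x, y, z]) (map (\<lambda>w. (tr 3, w)) ts)) = concat ?ws"
    by (simp add: comp_def)
  have d: "distinct (arc_labels cs @ ?I)"
    using dist msI by (metis distinct_append mset_eq_imp_distinct_iff mset_eq_setD)
  \<comment> \<open>The permutation is done in two stages: the outer legs are sorted into
    \<open>as\<close> followed by \<open>as'\<close>, and then only the inputs of the words are
    permuted, away from the outputs.\<close>
  have "perm (arc_labels cs @ ?I) (concat ?ws @ as')
    = perm ((arc_labels cs @ as) @ as') (concat ?ws @ as') \<cdot> perm (arc_labels cs @ ?I) (arc_labels cs @ as @ as')"
    using ms msI d perm_comp[of "arc_labels cs @ ?I" "arc_labels cs @ as @ as'" "concat ?ws @ as'"] by simp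
  also have "\<dots> = (perm (arc_labels cs @ as) (concat ?ws) \<otimes> \<iota> (pow as')) \<cdot> (\<iota> (pow (arc_labels cs)) \<otimes> perm ?I (as @ as'))"
    using ms msI by (simp only: perm_append perm_refl)
  finally have P: "perm (arc_labels cs @ ?I) (concat ?ws @ as')
    = (perm (arc_labels cs @ as) (concat ?ws) \<otimes> \<iota> (pow as')) \<cdot> (\<iota> (pow (arc_labels cs)) \<otimes> perm ?I (as @ as'))" .
  have k_as': "flips k as' = \<iota> (pow as')" and k_cs: "flips k (arc_labels cs) = \<iota> (pow (arc_labels cs))"
    using k by (auto intro: flips_id)
  have "(\<iota> (pow (arc_labels cs)) \<otimes> perm ?I (as @ as')) \<cdot> (arcs cs \<otimes> (flips k ?I \<cdot> ?S))
    = arcs cs \<otimes> (perm ?I (as @ as') \<cdot> flips k ?I \<cdot> ?S)"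
    using msI by (simp add: tensor_comp)
  also have "\<dots> = arcs cs \<otimes> ((flips k as \<otimes> \<iota> (pow as')) \<cdot> perm ?I (as @ as') \<cdot> ?S)"
    using msI perm_flips[OF msI, of k] k_as' Comp_assoc'[of ?S "flips k ?I" "perm ?I (as @ as')"] by simp
  also have "\<dots> = ((arcs cs \<otimes> flips k as) \<otimes> \<iota> (pow as')) \<cdot> perm ?I (as @ as') \<cdot> ?S"
    using msI tensor_comp[of "\<iota> \<one>" "arcs cs" "perm ?I (as @ as') \<cdot> ?S" "flips k as \<otimes> \<iota> (pow as')"] by simp
  finally have R: "(\<iota> (pow (arc_labels cs)) \<otimes> perm ?I (as @ as')) \<cdot> (arcs cs \<otimes> (flips k ?I \<cdot> ?S))
    = ((arcs cs \<otimes> flips k as) \<otimes> \<iota> (pow as')) \<cdot> perm ?I (as @ as') \<cdot> ?S" .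
  let ?n = "traces ?ws \<cdot> perm (arc_labels cs @ as) (concat ?ws) \<cdot> (arcs cs \<otimes> flips k as)"
  have "index_product C A (map (\<lambda>w. (tr 3, w)) ts)
      (map (\<lambda>(s, w). (cc s, w)) cs @ map (\<lambda>(a, a'). (cc (k a), a, a')) (zip as as')) as'
    = (traces ?ws \<otimes> \<iota> (pow as')) \<cdot> perm (arc_labels cs @ ?I) (concat ?ws @ as') \<cdot> (arcs cs \<otimes> ?Sk)"
  proof -
    have "?Sk \<in> Mor C" unfolding Sk by simp
    from cs[OF this] show ?thesis
      unfolding index_product_def ts tsw map_append[of "\<lambda>(c, x, x'). [x, x']"] concat_append csw I by simp
  qed
  also have "\<dots> = (traces ?ws \<otimes> \<iota> (pow as')) \<cdot> ((perm (arc_labels cs @ as) (concat ?ws) \<otimes> \<iota> (pow as')) \<cdot>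
      (\<iota> (pow (arc_labels cs)) \<otimes> perm ?I (as @ as'))) \<cdot> (arcs cs \<otimes> (flips k ?I \<cdot> ?S))"
    unfolding P Sk ..
  also have "\<dots> = (traces ?ws \<otimes> \<iota> (pow as')) \<cdot> (perm (arc_labels cs @ as) (concat ?ws) \<otimes> \<iota> (pow as')) \<cdot>
      ((\<iota> (pow (arc_labels cs)) \<otimes> perm ?I (as @ as')) \<cdot> (arcs cs \<otimes> (flips k ?I \<cdot> ?S)))"
    using ms msI by (subst Comp_assoc') simp_all
  also have "\<dots> = (?n \<otimes> \<iota> (pow as')) \<cdot> perm ?I (as @ as') \<cdot> ?S"
    unfolding R using ms msI by (simp add: tensor_comp' del: TensorMor_assoc)
  also have "?n = net k ?ws cs as"
    using ms k_cs tensor_comp[of "arcs cs" "\<iota> (pow (arc_labels cs))" "\<iota> (pow as)" "flips k as"]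
    by (simp add: net_def val_def)
  finally show ?thesis .
qed

text \<open>The outer factor in \<open>index_product_net\<close> depends only on \<open>as\<close>
  and \<open>as'\<close>, so comparing index expressions reduces to comparing nets.\<close>

lemma index_product_eqI:
  fixes ts ts' :: "('l \<times> 'l \<times> 'l) list" and cs cs' :: "(bool \<times> 'l \<times> 'l) list" and as as' :: "'l list"
  assumes "net k (map (\<lambda>(x, y, z). [x, y, z]) ts) cs as = net k' (map (\<lambda>(x, y, z). [x, y, z]) ts') cs' as"
    and "length as = length as'"
    and "mset (arc_labels cs @ as) = mset (concat (map (\<lambda>(x, y, z). [x, y, z]) ts))"
    and "mset (arc_labels cs' @ as) = mset (concat (map (\<lambda>(x, y, z). [x, y, z]) ts'))"
    and "distinct (arc_labels cs @ as @ as')" "distinct (arc_labels cs' @ as @ as')"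
    and "\<forall>l\<in>set (arc_labels cs @ as'). \<not> k l" "\<forall>l\<in>set (arc_labels cs' @ as'). \<not> k' l"
  shows "index_product C A (map (\<lambda>w. (tr 3, w)) ts)
      (map (\<lambda>(s, w). (cc s, w)) cs @ map (\<lambda>(a, a'). (cc (k a), a, a')) (zip as as')) as'
    = index_product C A (map (\<lambda>w. (tr 3, w)) ts')
      (map (\<lambda>(s, w). (cc s, w)) cs' @ map (\<lambda>(a, a'). (cc (k' a), a, a')) (zip as as')) as'"
  using index_product_net[of as as' cs ts k] index_product_net[of as as' cs' ts' k'] assms by auto

section \<open>The relations\<close>

lemma tr_3: "tr 3 = \<epsilon> \<cdot> \<mu> \<cdot> (\<mu> \<otimes> \<iota> A)"
proof -
  have "tr 3 = \<epsilon> \<cdot> \<mu> \<cdot> (\<iota> A \<otimes> (\<mu> \<cdot> (\<iota> A \<otimes> (\<mu> \<cdot> (\<iota> A \<otimes> \<eta>)))))"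
    by (simp add: tr_def eval_nat_numeral)
  then show ?thesis unfolding mult_unit_right mult_assoc by simp
qed

text \<open>The sign assignments differ on every letter of a single word, so \<open>N\<close> on the
  whole word relates them.\<close>

lemma relation_flip:
  "index_product C A [(tr 3, Lx, Ly, Lz)]
      [(cc \<alpha>, Lx, Lx'), (cc \<beta>, Ly, Ly'), (cc \<gamma>, Lz, Lz')] [Lx', Ly', Lz'] =
    index_product C A [(tr 3, Lx, Ly, Lz)]
      [(cc (\<not> \<alpha>), Lx, Lx'), (cc (\<not> \<beta>), Ly, Ly'), (cc (\<not> \<gamma>), Lz, Lz')] [Lx', Ly', Lz']"
proof -
  let ?k = "(\<lambda>_. False)(Lx := \<alpha>, Ly := \<beta>, Lz := \<gamma>)"
  let ?k' = "(\<lambda>_. False)(Lx := \<not> \<alpha>, Ly := \<not> \<beta>, Lz := \<not> \<gamma>)"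
  have "net ?k [[Lx, Ly, Lz]] [] [Lx, Ly, Lz]
      = net (\<lambda>l. ?k l \<noteq> (l \<in> set [Lx, Ly, Lz])) [[Lx, Ly, Lz]] [] [Lx, Ly, Lz]"
    by (rule net_flip_word) simp_all
  also have "\<dots> = net ?k' [[Lx, Ly, Lz]] [] [Lx, Ly, Lz]"
    by (rule net_cong) auto
  finally show ?thesis
    using index_product_eqI[of ?k "[(Lx, Ly, Lz)]" "[]" "[Lx, Ly, Lz]" ?k' "[(Lx, Ly, Lz)]" "[]" "[Lx', Ly', Lz']"]
    by simp
qed

text \<open>Rotating \<open>Lx\<close> from the end of the right-hand word to its front applies
  \<open>N\<close> to that letter alone.\<close>

lemma relation_cyclic:
  "index_product C A [(tr 3, Lx, Ly, Lz)]
      [(cc \<alpha>, Lx, Lx'), (cc \<beta>, Ly, Ly'), (cc \<gamma>, Lz, Lz')] [Lx', Ly', Lz'] =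
    index_product C A [(tr 3, Ly, Lz, Lx)]
      [(cc (\<not> \<alpha>), Lx, Lx'), (cc \<beta>, Ly, Ly'), (cc \<gamma>, Lz, Lz')] [Lx', Ly', Lz']"
proof -
  let ?k = "(\<lambda>_. False)(Lx := \<alpha>, Ly := \<beta>, Lz := \<gamma>)"
  let ?k' = "(\<lambda>_. False)(Lx := \<not> \<alpha>, Ly := \<beta>, Lz := \<gamma>)"
  have "net ?k' ([[Ly, Lz] @ [Lx]]) [] [Lx, Ly, Lz]
      = net (\<lambda>l. ?k' l \<noteq> (l = Lx)) [[Lx, Ly, Lz]] [] [Lx, Ly, Lz]"
    by (rule net_cyclic) simp_all
  also have "\<dots> = net ?k [[Lx, Ly, Lz]] [] [Lx, Ly, Lz]"
    by (rule net_cong) auto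
  finally show ?thesis
    using index_product_eqI[of ?k "[(Lx, Ly, Lz)]" "[]" "[Lx, Ly, Lz]" ?k' "[(Ly, Lz, Lx)]" "[]" "[Lx', Ly', Lz']"]
    by simp
qed

text \<open>Joining along \<open>Lu\<close> and \<open>Lv\<close> yields a four-letter word on
  either side; rotating \<open>La\<close> aligns the two, leaving only exponents to compare.\<close>

lemma relation_exchange:
  "index_product C A [(tr 3, Lu, La, Lb), (tr 3, Lv, Lc, Ld)]
      [(cc s, Lu, Lv), (cc sA, La, La'), (cc sB, Lb, Lb'), (cc sC, Lc, Lc'), (cc sD, Ld, Ld')]
      [La', Lb', Lc', Ld'] =
    index_product C A [(tr 3, Lu, Lb, Lc), (tr 3, Lv, Ld, La)]
      [(cc s, Lu, Lv), (cc sA, La, La'), (cc ((\<not> s) = sB), Lb, Lb'), (cc (\<not> sC), Lc, Lc'),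
       (cc ((\<not> s) = sD), Ld, Ld')]
      [La', Lb', Lc', Ld']"
proof -
  let ?k = "(\<lambda>_. False)(La := sA, Lb := sB, Lc := sC, Ld := sD)"
  let ?k' = "(\<lambda>_. False)(La := sA, Lb := ((\<not> s) = sB), Lc := (\<not> sC), Ld := ((\<not> s) = sD))"
  let ?as = "[La, Lb, Lc, Ld]"
  let ?l = "\<lambda>l. ?k l \<noteq> (l \<in> set [La, Lb] \<and> s \<noteq> (?k Lu = ?k Lv))"
  let ?l' = "\<lambda>l. ?k' l \<noteq> (l \<in> set [Lb, Lc] \<and> s \<noteq> (?k' Lu = ?k' Lv))"
  have l: "net ?k [Lu # [La, Lb], Lv # [Lc, Ld]] [(s, Lu, Lv)] ?as = net ?l [[La, Lb] @ [Lc, Ld]] [] ?as"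
    by (rule net_join) simp_all
  have "net ?k' [Lu # [Lb, Lc], Lv # [Ld, La]] [(s, Lu, Lv)] ?as = net ?l' [[Lb, Lc] @ [Ld, La]] [] ?as"
    by (rule net_join) simp_all
  also have "\<dots> = net ?l' [[Lb, Lc, Ld] @ [La]] [] ?as" by simp
  also have "\<dots> = net (\<lambda>l. ?l' l \<noteq> (l = La)) [[La, Lb, Lc, Ld]] [] ?as"
    by (rule net_cyclic) simp_all
  also have "\<dots> = net ?l [[La, Lb, Lc, Ld]] [] ?as"
  \<comment> \<open>For \<open>s\<close> true the exponents differ on all four letters, so the whole
    word is flipped; for \<open>s\<close> false they agree.\<close>
  proof (cases s)
    case True
    have "net ?l [[La, Lb, Lc, Ld]] [] ?as = net (\<lambda>l. ?l l \<noteq> (l \<in> set ?as)) [[La, Lb, Lc, Ld]] [] ?as"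
      by (rule net_flip_word) simp_all
    also have "\<dots> = net (\<lambda>l. ?l' l \<noteq> (l = La)) [[La, Lb, Lc, Ld]] [] ?as"
      by (rule net_cong) (use True in auto)
    finally show ?thesis ..
  next
    case False
    then show ?thesis by (intro net_cong) auto
  qed
  finally have "net ?k [[Lu, La, Lb], [Lv, Lc, Ld]] [(s, Lu, Lv)] ?as
      = net ?k' [[Lu, Lb, Lc], [Lv, Ld, La]] [(s, Lu, Lv)] ?as"
    using l by simp
  then show ?thesis
    using index_product_eqI[of ?k "[(Lu, La, Lb), (Lv, Lc, Ld)]" "[(s, Lu, Lv)]" ?as
      ?k' "[(Lu, Lb, Lc), (Lv, Ld, La)]" "[(s, Lu, Lv)]" "[La', Lb', Lc', Ld']"]
    by simp
qed

text \<open>The three words are joined along \<open>Lu\<close>, \<open>Lu'\<close> and then along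
  \<open>Lv\<close>, \<open>Lv'\<close>; a final rotation makes \<open>Lw\<close> and
  \<open>Lw'\<close> adjacent so that they form a bubble. The assignments \<open>?k1\<close> to
  \<open>?k8\<close> record the exponents after each move.\<close>

lemma relation_triangle:
  assumes "\<not> ((s12 = s23) = s31)"
  shows "index_product C A [(tr 3, La, Lu, Lw'), (tr 3, Lb, Lv, Lu'), (tr 3, Lc, Lw, Lv')]
      [(cc s12, Lu, Lu'), (cc s23, Lv, Lv'), (cc s31, Lw, Lw'),
       (cc sA, La, La'), (cc sB, Lb, Lb'), (cc sC, Lc, Lc')] [La', Lb', Lc'] =
    index_product C A [(tr 3, La, Lb, Lc)]
      [(cc sA, La, La'), (cc (s12 = sB), Lb, Lb'), (cc ((\<not> s31) = sC), Lc, Lc')] [La', Lb', Lc']"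
proof -
  let ?as = "[La, Lb, Lc]"
  let ?c3 = "[(s31, Lw, Lw')]"
  let ?c2 = "(s23, Lv, Lv') # ?c3"
  let ?c1 = "(s12, Lu, Lu') # ?c2"
  let ?k0 = "(\<lambda>_. False)(La := sA, Lb := sB, Lc := sC)"
  let ?k' = "(\<lambda>_. False)(La := sA, Lb := (s12 = sB), Lc := ((\<not> s31) = sC))"
  let ?k1 = "\<lambda>l. ?k0 l \<noteq> (l = Lw')"
  let ?k2 = "\<lambda>l. ?k1 l \<noteq> (l = Lu)"
  let ?k3 = "\<lambda>l. ?k2 l \<noteq> (l = Lu')"
  let ?k4 = "\<lambda>l. ?k3 l \<noteq> (l \<in> set [Lw', La] \<and> s12 \<noteq> (?k3 Lu = ?k3 Lu'))"
  let ?k5 = "\<lambda>l. ?k4 l \<noteq> (l = Lv)"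
  let ?k6 = "\<lambda>l. ?k5 l \<noteq> (l = Lv')"
  let ?k7 = "\<lambda>l. ?k6 l \<noteq> (l \<in> set [Lw', La, Lb] \<and> s23 \<noteq> (?k6 Lv = ?k6 Lv'))"
  let ?k8 = "\<lambda>l. ?k7 l \<noteq> (l = Lw)"
  have "net ?k0 [[La, Lu] @ [Lw'], [Lb, Lv, Lu'], [Lc, Lw, Lv']] ?c1 ?as
      = net ?k1 [Lw' # [La, Lu], [Lb, Lv, Lu'], [Lc, Lw, Lv']] ?c1 ?as"
    by (rule net_cyclic) simp_all
  also have "\<dots> = net ?k1 [[Lw', La] @ [Lu], [Lb, Lv, Lu'], [Lc, Lw, Lv']] ?c1 ?as" by simp
  also have "\<dots> = net ?k2 [Lu # [Lw', La], [Lb, Lv, Lu'], [Lc, Lw, Lv']] ?c1 ?as"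
    by (rule net_cyclic) simp_all
  \<comment> \<open>Rotation acts on the first word only, so the other words are swapped to the
    front and back again.\<close>
  also have "\<dots> = net ?k2 ([Lu # [Lw', La]] @ [[Lb, Lv] @ [Lu'], [Lc, Lw, Lv']]) ?c1 ?as" by simp
  also have "\<dots> = net ?k2 ([[Lb, Lv] @ [Lu'], [Lc, Lw, Lv']] @ [Lu # [Lw', La]]) ?c1 ?as"
    by (rule net_swap) simp_all
  also have "\<dots> = net ?k2 (([Lb, Lv] @ [Lu']) # [[Lc, Lw, Lv'], Lu # [Lw', La]]) ?c1 ?as" by simp
  also have "\<dots> = net ?k3 ((Lu' # [Lb, Lv]) # [[Lc, Lw, Lv'], Lu # [Lw', La]]) ?c1 ?as"
    by (rule net_cyclic) simp_all
  also have "\<dots> = net ?k3 ([Lu' # [Lb, Lv], [Lc, Lw, Lv']] @ [Lu # [Lw', La]]) ?c1 ?as" by simp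
  also have "\<dots> = net ?k3 ([Lu # [Lw', La]] @ [Lu' # [Lb, Lv], [Lc, Lw, Lv']]) ?c1 ?as"
    by (rule net_swap) simp_all
  also have "\<dots> = net ?k3 ((Lu # [Lw', La]) # (Lu' # [Lb, Lv]) # [[Lc, Lw, Lv']]) ?c1 ?as" by simp
  also have "\<dots> = net ?k4 (([Lw', La] @ [Lb, Lv]) # [[Lc, Lw, Lv']]) ?c2 ?as"
    by (rule net_join) simp_all
  also have "\<dots> = net ?k4 (([Lw', La, Lb] @ [Lv]) # [[Lc, Lw, Lv']]) ?c2 ?as" by simp
  also have "\<dots> = net ?k5 ((Lv # [Lw', La, Lb]) # [[Lc, Lw, Lv']]) ?c2 ?as"
    by (rule net_cyclic) simp_all
  also have "\<dots> = net ?k5 ([Lv # [Lw', La, Lb]] @ [[Lc, Lw] @ [Lv']]) ?c2 ?as" by simp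
  also have "\<dots> = net ?k5 ([[Lc, Lw] @ [Lv']] @ [Lv # [Lw', La, Lb]]) ?c2 ?as"
    by (rule net_swap) simp_all
  also have "\<dots> = net ?k5 (([Lc, Lw] @ [Lv']) # [Lv # [Lw', La, Lb]]) ?c2 ?as" by simp
  also have "\<dots> = net ?k6 ((Lv' # [Lc, Lw]) # [Lv # [Lw', La, Lb]]) ?c2 ?as"
    by (rule net_cyclic) simp_all
  also have "\<dots> = net ?k6 ([Lv' # [Lc, Lw]] @ [Lv # [Lw', La, Lb]]) ?c2 ?as" by simp
  also have "\<dots> = net ?k6 ([Lv # [Lw', La, Lb]] @ [Lv' # [Lc, Lw]]) ?c2 ?as"
    by (rule net_swap) simp_all
  also have "\<dots> = net ?k6 ((Lv # [Lw', La, Lb]) # (Lv' # [Lc, Lw]) # []) ?c2 ?as" by simp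
  also have "\<dots> = net ?k7 [[Lw', La, Lb] @ [Lc, Lw]] ?c3 ?as"
    by (rule net_join) simp_all
  also have "\<dots> = net ?k7 [[Lw', La, Lb, Lc] @ [Lw]] ?c3 ?as" by simp
  also have "\<dots> = net ?k8 [Lw # [Lw', La, Lb, Lc]] ?c3 ?as"
    by (rule net_cyclic) simp_all
  \<comment> \<open>The accumulated exponents are \<open>True\<close> at \<open>Lw\<close> and
    \<open>s12 = s23\<close> at \<open>Lw'\<close>; the assumption on the signs is exactly the
    condition for deleting the bubble.\<close>
  also have "\<dots> = net ?k8 [[La, Lb, Lc]] [] ?as"
    by (rule net_bubble) (use assms in auto)
  also have "\<dots> = net ?k' [[La, Lb, Lc]] [] ?as"
  \<comment> \<open>If \<open>s31\<close> holds, \<open>s12\<close> and \<open>s23\<close> differ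
    and all three exponents are opposite to \<open>?k'\<close>; otherwise they coincide with
    it.\<close>
  proof (cases s31)
    case True
    have "net ?k' [[La, Lb, Lc]] [] ?as = net (\<lambda>l. ?k' l \<noteq> (l \<in> set ?as)) [[La, Lb, Lc]] [] ?as"
      by (rule net_flip_word) simp_all
    also have "\<dots> = net ?k8 [[La, Lb, Lc]] [] ?as"
      by (rule net_cong) (use assms True in auto)
    finally show ?thesis ..
  next
    case False
    show ?thesis by (rule net_cong) (use assms False in auto)
  qed
  finally have "net ?k0 [[La, Lu, Lw'], [Lb, Lv, Lu'], [Lc, Lw, Lv']] ?c1 ?as = net ?k' [[La, Lb, Lc]] [] ?as"
    by simp
  then show ?thesis
    using index_product_eqI[of ?k0 "[(La, Lu, Lw'), (Lb, Lv, Lu'), (Lc, Lw, Lv')]" ?c1 ?as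
      ?k' "[(La, Lb, Lc)]" "[]" "[La', Lb', Lc']"]
    by simp
qed

end

section \<open>Translation between integer signs and Booleans\<close>

definition sign :: "bool \<Rightarrow> int" where "sign p = (if p then 1 else -1)"

lemma ball_sign: "(\<forall>s\<in>{1, -1}. P s) \<longleftrightarrow> (\<forall>p. P (sign p))"
  by (auto simp: sign_def split: if_splits)

text \<open>These rules turn the sign expressions of the theorem into the Boolean forms of the
  relation lemmas, for instance \<open>- s * s\<^sub>B\<close> into
  \<open>(\<not> s) = sB\<close>.\<close>

lemma sign_simps:
  "- sign p = sign (\<not> p)" "sign p * sign q = sign (p = q)" "sign p = -1 \<longleftrightarrow> \<not> p"
  by (simp_all add: sign_def)

theorem proposition4p9:
  fixes C :: "('o, 'm) monoidal_data" (structure)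
    and A :: 'o
    and \<mu> \<eta> \<Delta> \<epsilon> t :: 'm
    and c :: "int \<Rightarrow> 'm"
  assumes "symmetric_strict_monoidal_category C"
    and "frobenius_algebra C A \<mu> \<eta> \<Delta> \<epsilon>"
    and "Delta_separable C \<mu> \<eta> \<Delta>"
    and "nakayama C A \<mu> \<eta> \<Delta> \<epsilon> \<cdot> nakayama C A \<mu> \<eta> \<Delta> \<epsilon> = \<iota> A"
    and "t = \<epsilon> \<cdot> \<mu> \<cdot> (\<mu> \<otimes> \<iota> A)"
    and "c (-1) = \<Delta> \<cdot> \<eta>"
    and "c 1 = \<sigma> A A \<cdot> \<Delta> \<cdot> \<eta>"
  shows
    "t \<in> hom C (A \<odot> A \<odot> A) \<one> \<and>
     (\<forall>s\<in>{1, -1}. c s \<in> hom C \<one> (A \<odot> A)) \<and>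
     c 1 = \<sigma> A A \<cdot> c (-1) \<and>
     (\<forall>\<alpha>\<in>{1, -1}. \<forall>\<beta>\<in>{1, -1}. \<forall>\<gamma>\<in>{1, -1}.
       index_product C A [(t, Lx, Ly, Lz)]
         [(c \<alpha>, Lx, Lx'), (c \<beta>, Ly, Ly'), (c \<gamma>, Lz, Lz')] [Lx', Ly', Lz'] =
       index_product C A [(t, Lx, Ly, Lz)]
         [(c (- \<alpha>), Lx, Lx'), (c (- \<beta>), Ly, Ly'), (c (- \<gamma>), Lz, Lz')] [Lx', Ly', Lz']) \<and>
     (\<forall>\<alpha>\<in>{1, -1}. \<forall>\<beta>\<in>{1, -1}. \<forall>\<gamma>\<in>{1, -1}.
       index_product C A [(t, Lx, Ly, Lz)]
         [(c \<alpha>, Lx, Lx'), (c \<beta>, Ly, Ly'), (c \<gamma>, Lz, Lz')] [Lx', Ly', Lz'] =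
       index_product C A [(t, Ly, Lz, Lx)]
         [(c (- \<alpha>), Lx, Lx'), (c \<beta>, Ly, Ly'), (c \<gamma>, Lz, Lz')] [Lx', Ly', Lz']) \<and>
     (\<forall>s\<in>{1, -1}. \<forall>s\<^sub>A\<in>{1, -1}. \<forall>s\<^sub>B\<in>{1, -1}. \<forall>s\<^sub>C\<in>{1, -1}. \<forall>s\<^sub>D\<in>{1, -1}.
       index_product C A [(t, Lu, La, Lb), (t, Lv, Lc, Ld)]
         [(c s, Lu, Lv), (c s\<^sub>A, La, La'), (c s\<^sub>B, Lb, Lb'), (c s\<^sub>C, Lc, Lc'), (c s\<^sub>D, Ld, Ld')]
         [La', Lb', Lc', Ld'] =
       index_product C A [(t, Lu, Lb, Lc), (t, Lv, Ld, La)]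
         [(c s, Lu, Lv), (c s\<^sub>A, La, La'), (c (- s * s\<^sub>B), Lb, Lb'), (c (- s\<^sub>C), Lc, Lc'),
          (c (- s * s\<^sub>D), Ld, Ld')]
         [La', Lb', Lc', Ld']) \<and>
     (\<forall>s\<^sub>1\<^sub>2\<in>{1, -1}. \<forall>s\<^sub>2\<^sub>3\<in>{1, -1}. \<forall>s\<^sub>3\<^sub>1\<in>{1, -1}.
      \<forall>s\<^sub>A\<in>{1, -1}. \<forall>s\<^sub>B\<in>{1, -1}. \<forall>s\<^sub>C\<in>{1, -1}.
       s\<^sub>1\<^sub>2 * s\<^sub>2\<^sub>3 * s\<^sub>3\<^sub>1 = -1 \<longrightarrow>
       index_product C A [(t, La, Lu, Lw'), (t, Lb, Lv, Lu'), (t, Lc, Lw, Lv')]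
         [(c s\<^sub>1\<^sub>2, Lu, Lu'), (c s\<^sub>2\<^sub>3, Lv, Lv'), (c s\<^sub>3\<^sub>1, Lw, Lw'),
          (c s\<^sub>A, La, La'), (c s\<^sub>B, Lb, Lb'), (c s\<^sub>C, Lc, Lc')]
         [La', Lb', Lc'] =
       index_product C A [(t, La, Lb, Lc)]
         [(c s\<^sub>A, La, La'), (c (s\<^sub>1\<^sub>2 * s\<^sub>B), Lb, Lb'), (c (- s\<^sub>3\<^sub>1 * s\<^sub>C), Lc, Lc')]
         [La', Lb', Lc'])"
proof -
  interpret symmetric_strict_monoidal_category C by fact
  interpret frobenius_algebra C A \<mu> \<eta> \<Delta> \<epsilon> by fact
  interpret symmetric_frobenius_algebra C A \<mu> \<eta> \<Delta> \<epsilon> ..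
  interpret involutive_frobenius_algebra C A \<mu> \<eta> \<Delta> \<epsilon>
    using assms(3,4) by unfold_locales (simp_all add: Delta_separable_def)
  have t: "t = tr 3"
    by (simp add: tr_3 assms(5))
  have c: "c (sign p) = cc p" for p
    using assms(6,7) by (simp add: sign_def cc_def copair_def)
  have "tr 3 \<in> hom C (A \<odot> A \<odot> A) \<one>"
    using assms(5) t by (simp add: hom_iff)
  moreover have "c 1 = \<sigma> A A \<cdot> c (-1)"
    by (simp add: assms(6,7))
  ultimately show ?thesis
    unfolding ball_sign sign_simps c t
    by (intro conjI allI impI relation_flip relation_cyclic relation_exchange relation_triangle)
      (simp_all add: hom_iff)
qed

end
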